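(* Let $\theta$ be a uniclass automorphism of a finite thick irreducible spherical building $\Delta$ of type $(W,S)$, with fixed structure a Weyl substructure $\Delta'$ of type $(W',S')$ with parameters $q'=(q'_{s'})_{s'\in S'}$. Let $w_J$, $J\subseteq S$, be the unique minimal length element of $\mathrm{disp}(\theta)$. For $w\in\mathrm{disp}(\theta)$ we have $$|\Delta_w(\theta)|=W_J(q)\,W'(q')\,q_w^{1/2}q_{w_J}^{-1/2},$$ and writing $\mathbf{C}=\mathrm{disp}(\theta)$ we have $$\mathbf{C}(q^{1/2})=\frac{W(q)\,q_{w_J}^{1/2}}{W_J(q)\,W'(q')}.$$ Here $W'(q')$ is the Poincaré polynomial of $(W',S')$ (evaluated at $q'$), and so $W'(q')$ is the number of chambers of the Weyl substructure $\Delta'$.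
   Context: $\mathrm{Ch}(\Delta)$ is the chamber set and $\delta$ the Weyl distance of $\Delta$; $q_s=|\{D\in\mathrm{Ch}(\Delta)\mid\delta(C,D)=s\}|$ (independent of $C$), $q_w=q_{s_1}\cdots q_{s_n}$ for $w=s_1\cdots s_n$ reduced. For $U\subseteq W$, $U(q)=\sum_{w\in U}q_w$ and $U(q^{1/2})=\sum_{w\in U}q_w^{1/2}$; $W_J=\langle J\rangle$ with longest element $w_J$. The companion automorphism $\sigma$ of $\theta$ is the automorphism of the Coxeter graph with $\delta(C,D)=s\iff\delta(C^\theta,D^\theta)=s^\sigma$; $\mathrm{disp}(\theta)=\{\delta(C,C^\theta)\mid C\in\mathrm{Ch}(\Delta)\}$; $\theta$ is uniclass if $\mathrm{disp}(\theta)$ is contained in a single $\sigma$-conjugacy class $\{v^{-1}wv^\sigma\mid v\in W\}$. $\Delta_w(\theta)=\{C\in\mathrm{Ch}(\Delta)\mid\delta(C,C^\theta)=w\}$. For uniclass $\theta$ on a thick irreducible spherical building, $\mathrm{disp}(\theta)$ is a full $\sigma$-conjugacy class of $\sigma$-involutions (elements with $ww^\sigma=1$, $\sigma^2=1$) with a unique minimal length element, which is of the form $w_J$. The Weyl substructure $\Delta'$ associated with $\theta$ is the structure of simplices of $\Delta$ fixed by $\theta$; it is a spherical building of some type $(W',S')$, whose chambers are the simplices of type $S\setminus J$ of $\Delta$ fixed by $\theta$; its parameters $q'_{s'}$, $s'\in S'$, are defined as for $\Delta$ (number of chambers $s'$-adjacent to a given one), and $W'(q')=\sum_{w'\in W'}q'_{w'}$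 with $q'_{w'}$ defined by reduced expressions. *)

theory Defs
  imports Complex_Main "HOL-Algebra.Generated_Groups" "HOL-Algebra.Multiplicative_Group"
begin

section \<open>Coxeter systems\<close>

definition word_prod :: "('a, 'm) monoid_scheme \<Rightarrow> 'a list \<Rightarrow> 'a" where
  "word_prod W ws = foldr (\<lambda>x y. x \<otimes>\<^bsub>W\<^esub> y) ws \<one>\<^bsub>W\<^esub>"

text \<open>The order of \<open>s t\<close>; following \<^const>\<open>group.ord\<close>, the value 0 stands for infinite order.\<close>

definition coxeter_entry :: "('a, 'm) monoid_scheme \<Rightarrow> 'a \<Rightarrow> 'a \<Rightarrow> nat" where
  "coxeter_entry W s t = group.ord W (s \<otimes>\<^bsub>W\<^esub> t)"

text \<open>Equality of words in \<open>S\<close> in the group presented by the relations \<open>(s t)^m(s,t) = 1\<close>.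
  Since \<open>m(s,s) = 1\<close>, the relations \<open>s s = 1\<close> are included, so words need no formal
  inverses; an entry 0 contributes only the empty relation.\<close>

inductive coxeter_equiv :: "'a set \<Rightarrow> ('a \<Rightarrow> 'a \<Rightarrow> nat) \<Rightarrow> 'a list \<Rightarrow> 'a list \<Rightarrow> bool"
  for S :: "'a set" and m :: "'a \<Rightarrow> 'a \<Rightarrow> nat" where
  refl: "coxeter_equiv S m u u"
| sym: "coxeter_equiv S m u v \<Longrightarrow> coxeter_equiv S m v u"
| trans: "coxeter_equiv S m u v \<Longrightarrow> coxeter_equiv S m v w \<Longrightarrow> coxeter_equiv S m u w"
| relator: "s \<in> S \<Longrightarrow> t \<in> S \<Longrightarrow>
    coxeter_equiv S m (u @ concat (replicate (m s t) [s, t]) @ v) (u @ v)"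

locale coxeter_system = group W for W :: "('a, 'm) monoid_scheme" (structure) +
  fixes S :: "'a set"
  assumes finite_gens: "finite S"
    and gens_closed: "S \<subseteq> carrier W"
    and gens_order: "\<And>s. s \<in> S \<Longrightarrow> group.ord W s = 2"
    and gens_generate: "generate W S = carrier W"
    and presentation: "\<And>ws. ws \<in> lists S \<Longrightarrow> word_prod W ws = \<one> \<Longrightarrow>
          coxeter_equiv S (coxeter_entry W) ws []"

text \<open>Connectedness of the Coxeter graph, where \<open>s\<close> and \<open>t\<close> are joined iff \<open>m(s,t) \<ge> 3\<close> or
  \<open>m(s,t)\<close> is infinite.\<close>

definition irreducible_coxeter :: "('a, 'm) monoid_scheme \<Rightarrow> 'a set \<Rightarrow> bool" where
  "irreducible_coxeter W S \<longleftrightarrow> S \<noteq> {} \<and>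
     (\<forall>s\<in>S. \<forall>t\<in>S. (s, t) \<in> {(a, b). a \<in> S \<and> b \<in> S \<and> coxeter_entry W a b \<notin> {1, 2}}\<^sup>*)"

definition cox_length :: "('a, 'm) monoid_scheme \<Rightarrow> 'a set \<Rightarrow> 'a \<Rightarrow> nat" where
  "cox_length W S w = (LEAST n. \<exists>ws\<in>lists S. length ws = n \<and> word_prod W ws = w)"

definition is_reduced :: "('a, 'm) monoid_scheme \<Rightarrow> 'a set \<Rightarrow> 'a \<Rightarrow> 'a list \<Rightarrow> bool" where
  "is_reduced W S w ws \<longleftrightarrow> ws \<in> lists S \<and> word_prod W ws = w \<and> length ws = cox_length W S w"

definition longest_elt :: "('a, 'm) monoid_scheme \<Rightarrow> 'a set \<Rightarrow> 'a set \<Rightarrow> 'a" where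
  "longest_elt W S J = (THE w. w \<in> generate W J \<and>
     (\<forall>v\<in>generate W J. cox_length W S v \<le> cox_length W S w))"

text \<open>\<open>q\<^sub>w\<close>: the product of the parameters along a reduced expression of \<open>w\<close>. The expression is
  arbitrary; for the parameters of a building the value does not depend on it.\<close>

definition weight :: "('a, 'm) monoid_scheme \<Rightarrow> 'a set \<Rightarrow> ('a \<Rightarrow> real) \<Rightarrow> 'a \<Rightarrow> real" where
  "weight W S q w = prod_list (map q (SOME ws. is_reduced W S w ws))"

definition poincare :: "('a, 'm) monoid_scheme \<Rightarrow> 'a set \<Rightarrow> ('a \<Rightarrow> real) \<Rightarrow> 'a set \<Rightarrow> real" where
  "poincare W S q U = (\<Sum>w\<in>U. weight W S q w)"

definition poincare_sqrt :: "('a, 'm) monoid_scheme \<Rightarrow> 'a set \<Rightarrow> ('a \<Rightarrow> real) \<Rightarrow> 'a set \<Rightarrow> real" where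
  "poincare_sqrt W S q U = (\<Sum>w\<in>U. sqrt (weight W S q w))"


section \<open>Buildings\<close>

text \<open>Buildings of type \<open>(W,S)\<close> as \<open>W\<close>-metric spaces: chambers with a Weyl distance.\<close>

locale building = coxeter_system W S for W :: "('a, 'm) monoid_scheme" (structure) and S +
  fixes Ch :: "'c set" and \<delta> :: "'c \<Rightarrow> 'c \<Rightarrow> 'a"
  assumes chambers_nonempty: "Ch \<noteq> {}"
    and dist_closed: "\<And>C D. C \<in> Ch \<Longrightarrow> D \<in> Ch \<Longrightarrow> \<delta> C D \<in> carrier W"
    and WD1: "\<And>C D. C \<in> Ch \<Longrightarrow> D \<in> Ch \<Longrightarrow> \<delta> C D = \<one> \<longleftrightarrow> C = D"
    and WD2: "\<And>C D C' s. \<lbrakk>C \<in> Ch; D \<in> Ch; C' \<in> Ch; s \<in> S; \<delta> C' C = s\<rbrakk> \<Longrightarrow>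
          \<delta> C' D \<in> {s \<otimes> \<delta> C D, \<delta> C D}"
    and WD2': "\<And>C D C' s. \<lbrakk>C \<in> Ch; D \<in> Ch; C' \<in> Ch; s \<in> S; \<delta> C' C = s;
          cox_length W S (s \<otimes> \<delta> C D) = cox_length W S (\<delta> C D) + 1\<rbrakk> \<Longrightarrow>
          \<delta> C' D = s \<otimes> \<delta> C D"
    and WD3: "\<And>C D s. \<lbrakk>C \<in> Ch; D \<in> Ch; s \<in> S\<rbrakk> \<Longrightarrow>
          \<exists>C'\<in>Ch. \<delta> C' C = s \<and> \<delta> C' D = s \<otimes> \<delta> C D"

definition thick :: "'a set \<Rightarrow> 'c set \<Rightarrow> ('c \<Rightarrow> 'c \<Rightarrow> 'a) \<Rightarrow> bool" where
  "thick S Ch \<delta> \<longleftrightarrow> (\<forall>C\<in>Ch. \<forall>s\<in>S. \<exists>D\<in>Ch. \<exists>E\<in>Ch. D \<noteq> E \<and> \<delta> C D = s \<and> \<delta> C E = s)"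

text \<open>\<open>q\<^sub>s\<close>, read off at an arbitrary chamber; for the buildings considered here the number does not
  depend on the chamber.\<close>

definition param :: "'c set \<Rightarrow> ('c \<Rightarrow> 'c \<Rightarrow> 'a) \<Rightarrow> 'a \<Rightarrow> real" where
  "param Ch \<delta> s = real (card {D \<in> Ch. \<delta> (SOME C. C \<in> Ch) D = s})"

text \<open>The residues of type \<open>J\<close> are the simplices of type \<open>S - J\<close>, a residue being the set of chambers
  that contain the simplex; the face relation on simplices is reverse inclusion of residues.\<close>

definition residues_of_type ::
  "('a, 'm) monoid_scheme \<Rightarrow> 'c set \<Rightarrow> ('c \<Rightarrow> 'c \<Rightarrow> 'a) \<Rightarrow> 'a set \<Rightarrow> 'c set set" where
  "residues_of_type W Ch \<delta> J = {{D \<in> Ch. \<delta> C D \<in> generate W J} | C. C \<in> Ch}"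

definition residues ::
  "('a, 'm) monoid_scheme \<Rightarrow> 'a set \<Rightarrow> 'c set \<Rightarrow> ('c \<Rightarrow> 'c \<Rightarrow> 'a) \<Rightarrow> 'c set set" where
  "residues W S Ch \<delta> = (\<Union>J\<in>Pow S. residues_of_type W Ch \<delta> J)"


section \<open>Automorphisms and displacement\<close>

text \<open>The companion automorphism of the Coxeter graph is represented by its (unique) extension to an
  automorphism \<open>\<sigma>\<close> of \<open>W\<close>; conversely an automorphism of \<open>W\<close> stabilising \<open>S\<close> preserves all \<open>m(s,t)\<close>.\<close>

definition building_automorphism ::
  "('a, 'm) monoid_scheme \<Rightarrow> 'a set \<Rightarrow> 'c set \<Rightarrow> ('c \<Rightarrow> 'c \<Rightarrow> 'a) \<Rightarrow> ('c \<Rightarrow> 'c) \<Rightarrow> ('a \<Rightarrow> 'a) \<Rightarrow> bool" where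
  "building_automorphism W S Ch \<delta> \<theta> \<sigma> \<longleftrightarrow>
     bij_betw \<theta> Ch Ch \<and> \<sigma> \<in> iso W W \<and> \<sigma> ` S = S \<and>
     (\<forall>C\<in>Ch. \<forall>D\<in>Ch. \<forall>s\<in>S. \<delta> C D = s \<longleftrightarrow> \<delta> (\<theta> C) (\<theta> D) = \<sigma> s)"

definition disp :: "'c set \<Rightarrow> ('c \<Rightarrow> 'c \<Rightarrow> 'a) \<Rightarrow> ('c \<Rightarrow> 'c) \<Rightarrow> 'a set" where
  "disp Ch \<delta> \<theta> = {\<delta> C (\<theta> C) | C. C \<in> Ch}"

definition twisted_class :: "('a, 'm) monoid_scheme \<Rightarrow> ('a \<Rightarrow> 'a) \<Rightarrow> 'a \<Rightarrow> 'a set" where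
  "twisted_class W \<sigma> w = {inv\<^bsub>W\<^esub> v \<otimes>\<^bsub>W\<^esub> w \<otimes>\<^bsub>W\<^esub> \<sigma> v | v. v \<in> carrier W}"

definition uniclass ::
  "('a, 'm) monoid_scheme \<Rightarrow> 'c set \<Rightarrow> ('c \<Rightarrow> 'c \<Rightarrow> 'a) \<Rightarrow> ('c \<Rightarrow> 'c) \<Rightarrow> ('a \<Rightarrow> 'a) \<Rightarrow> bool" where
  "uniclass W Ch \<delta> \<theta> \<sigma> \<longleftrightarrow> (\<exists>w\<in>carrier W. disp Ch \<delta> \<theta> \<subseteq> twisted_class W \<sigma> w)"

definition displaced :: "'c set \<Rightarrow> ('c \<Rightarrow> 'c \<Rightarrow> 'a) \<Rightarrow> ('c \<Rightarrow> 'c) \<Rightarrow> 'a \<Rightarrow> 'c set" where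
  "displaced Ch \<delta> \<theta> w = {C \<in> Ch. \<delta> C (\<theta> C) = w}"

definition unique_min_length :: "('a, 'm) monoid_scheme \<Rightarrow> 'a set \<Rightarrow> 'a set \<Rightarrow> 'a \<Rightarrow> bool" where
  "unique_min_length W S U w \<longleftrightarrow>
     w \<in> U \<and> (\<forall>v\<in>U. v \<noteq> w \<longrightarrow> cox_length W S w < cox_length W S v)"


section \<open>The fixed structure\<close>

definition fixed_residues ::
  "('a, 'm) monoid_scheme \<Rightarrow> 'a set \<Rightarrow> 'c set \<Rightarrow> ('c \<Rightarrow> 'c \<Rightarrow> 'a) \<Rightarrow> ('c \<Rightarrow> 'c) \<Rightarrow> 'c set set" where
  "fixed_residues W S Ch \<delta> \<theta> = {R \<in> residues W S Ch \<delta>. \<theta> ` R = R}"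

definition fixed_chambers ::
  "('a, 'm) monoid_scheme \<Rightarrow> 'c set \<Rightarrow> ('c \<Rightarrow> 'c \<Rightarrow> 'a) \<Rightarrow> ('c \<Rightarrow> 'c) \<Rightarrow> 'a set \<Rightarrow> 'c set set" where
  "fixed_chambers W Ch \<delta> \<theta> J = {T \<in> residues_of_type W Ch \<delta> J. \<theta> ` T = T}"

text \<open>The simplices fixed by \<open>\<theta>\<close> form a spherical building of type \<open>(W',S')\<close> with Weyl distance \<open>\<delta>'\<close>,
  the chambers being the fixed simplices of type \<open>S - J\<close>. As in any building, a simplex is given by
  the set of chambers containing it: the fixed simplex \<open>R\<close> is the residue \<open>{T. T \<subseteq> R}\<close> of the
  fixed building. Such a bijection is an isomorphism for inclusion, since both families are
  closed under nonempty intersections.\<close>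

definition is_fixed_building ::
  "('a, 'm) monoid_scheme \<Rightarrow> 'a set \<Rightarrow> 'c set \<Rightarrow> ('c \<Rightarrow> 'c \<Rightarrow> 'a) \<Rightarrow> ('c \<Rightarrow> 'c) \<Rightarrow> 'a set \<Rightarrow>
   ('b, 'n) monoid_scheme \<Rightarrow> 'b set \<Rightarrow> ('c set \<Rightarrow> 'c set \<Rightarrow> 'b) \<Rightarrow> bool" where
  "is_fixed_building W S Ch \<delta> \<theta> J W' S' \<delta>' \<longleftrightarrow>
     building W' S' (fixed_chambers W Ch \<delta> \<theta> J) \<delta>' \<and> finite (carrier W') \<and>
     bij_betw (\<lambda>R. {T \<in> fixed_chambers W Ch \<delta> \<theta> J. T \<subseteq> R})
       (fixed_residues W S Ch \<delta> \<theta>)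
       (residues W' S' (fixed_chambers W Ch \<delta> \<theta> J) \<delta>')"

end

theory Submission
  imports Defs "HOL-Library.Disjoint_Sets"
begin

text \<open>Let \<open>C\<close> have displacement \<open>w\<close> and let \<open>t = s\<^sup>\<sigma>\<close>. Uniclass forces the lengths of all displacements to
  have the same parity, and together with thickness this leaves only three shapes for the
  \<open>s\<close>-panel of \<open>C\<close>: all its chambers have displacement \<open>w = s w t\<close>, or exactly one of them has the
  shorter of \<open>w\<close> and \<open>s w t\<close>, whose lengths differ by 2. Counting pairs of adjacent chambers,
  \<open>|\<Delta>\<^sub>w| / q\<^sub>w\<^sup>1\<^sup>/\<^sup>2\<close> is therefore constant on twisted classes. Since \<open>\<Delta>\<^sub>w\<close> for \<open>w = w\<^sub>J\<close> is partitioned by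
  the fixed residues of type \<open>J\<close>, both formulas follow with the number of these residues in place
  of \<open>W'(q')\<close>.

  The same count inside a fixed residue of type \<open>K\<close> shows that the number of fixed chambers below it
  depends only on \<open>K\<close>. As the type of the panels of the fixed building depends only on \<open>s'\<close>, the
  fixed building has constant parameters, although it is not assumed to be thick, and so it has
  \<open>W'(q')\<close> chambers.\<close>

section \<open>Coxeter systems: exchange condition, parabolic subgroups, longest elements\<close>

text \<open>Square roots appear because lengthening a displacement \<open>w\<close> to
  \<open>s w (\<sigma> s)\<close> multiplies the number of chambers by \<open>q s\<close>, but the
  weight by \<open>q s * q (\<sigma> s)\<close>, which is the square of \<open>q s\<close> since
  \<theta> carries \<open>s\<close>-panels to \<open>\<sigma> s\<close>-panels. Parity leaves no
  room for the displacements \<open>s w\<close> and \<open>w (\<sigma> s)\<close>: \<sigma>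
  preserves length, so \<sigma>-conjugation changes lengths by even amounts only.

  The delicate point is the fixed building. All that links \<delta>' to \<delta> is a bijection
  between fixed residues and residues of the fixed building, so the type of a panel has to be
  recovered from inclusions alone. The fixed residues through a fixed chamber are indexed by the
  \<sigma>-stable types above \<open>J\<close>, and this ordered set is matched with the subsets of
  \<open>S'\<close>. There the type of an \<open>s\<close>-panel is the lattice complement of the
  type of the residue for \<open>S' - {s}\<close>, and the latter is kept whenever a panel of
  another type is crossed. Hence the type of a panel is constant along galleries of the fixed
  building.\<close>

lemma word_prod_Nil [simp]: "word_prod G [] = \<one>\<^bsub>G\<^esub>"
  and word_prod_Cons [simp]: "word_prod G (x # xs) = x \<otimes>\<^bsub>G\<^esub> word_prod G xs"
  by (simp_all add: word_prod_def)

text \<open>For a word \<open>s\<^sub>1 \<dots> s\<^sub>n\<close>, the number of \<open>i\<close> with \<open>s\<^sub>1 \<dots> s\<^sub>i \<dots> s\<^sub>1 = x\<close>. Its parity depends only on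
  the product of the word, which yields the exchange condition.\<close>

primrec refl_count :: "('a, 'm) monoid_scheme \<Rightarrow> 'a list \<Rightarrow> 'a \<Rightarrow> nat" where
  "refl_count G [] x = 0"
| "refl_count G (s # ws) x = of_bool (x = s) + refl_count G ws (s \<otimes>\<^bsub>G\<^esub> x \<otimes>\<^bsub>G\<^esub> s)"

context coxeter_system
begin

abbreviation len :: "'a \<Rightarrow> nat" where
  "len \<equiv> cox_length W S"

section \<open>Words in the generators and length\<close>

lemma gen_closed [simp, intro]: "s \<in> S \<Longrightarrow> s \<in> carrier W"
  using gens_closed by auto

lemma gen_square [simp]: "s \<in> S \<Longrightarrow> s \<otimes> s = \<one>"
  using pow_ord_eq_1[of s] gens_order[of s] by (simp add: numeral_2_eq_2)

lemma gen_inv [simp]: "s \<in> S \<Longrightarrow> inv s = s"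
  by (rule inv_equality) auto

lemma gen_not_one: "s \<in> S \<Longrightarrow> s \<noteq> \<one>"
  using gens_order[of s] ord_eq_1[of "\<one>"] by auto

lemma gen_cancel [simp]: "s \<in> S \<Longrightarrow> x \<in> carrier W \<Longrightarrow> s \<otimes> (s \<otimes> x) = x"
  by (simp flip: m_assoc)

lemma gen_cancel_right [simp]: "s \<in> S \<Longrightarrow> x \<in> carrier W \<Longrightarrow> x \<otimes> s \<otimes> s = x"
  by (simp add: m_assoc)

lemma gen_mult_ne: "s \<in> S \<Longrightarrow> x \<in> carrier W \<Longrightarrow> s \<otimes> x \<noteq> x"
  using gen_not_one by auto

lemma lists_gens_mono: "J \<subseteq> S \<Longrightarrow> ws \<in> lists J \<Longrightarrow> ws \<in> lists S"
  by auto

lemma word_prod_closed [simp, intro]: "ws \<in> lists S \<Longrightarrow> word_prod W ws \<in> carrier W"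
  by (induction ws) auto

lemma word_prod_append:
  "us \<in> lists S \<Longrightarrow> vs \<in> lists S \<Longrightarrow> word_prod W (us @ vs) = word_prod W us \<otimes> word_prod W vs"
  by (induction us) (auto simp: m_assoc)

lemma word_prod_rev: "ws \<in> lists S \<Longrightarrow> word_prod W (rev ws) = inv (word_prod W ws)"
  proof (induction ws rule: list.induct)
  case (Cons s ws)
  then have "s \<in> S" "ws \<in> lists S" "rev ws \<in> lists S" by simp_all (simp add: in_lists_conv_set)
  then show ?case using Cons.IH word_prod_append[of "rev ws" "[s]"] by (simp add: inv_mult_group)
qed simp

lemma generate_words:
  assumes "J \<subseteq> S"
  shows "generate W J = word_prod W ` lists J"
proof (intro equalityI subsetI)
  fix w assume "w \<in> generate W J"
  then show "w \<in> word_prod W ` lists J"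
  proof induction
    case one
    show ?case by (rule image_eqI[of _ _ "[]"]) auto
  next
    case (incl h)
    then show ?case using assms by (intro image_eqI[of _ _ "[h]"]) auto
  next
    case (inv h)
    then show ?case using assms by (intro image_eqI[of _ _ "[h]"]) auto
  next
    case (eng h1 h2)
    then obtain us vs where "us \<in> lists J" "h1 = word_prod W us" "vs \<in> lists J" "h2 = word_prod W vs"
      by auto
    then show ?case using assms
      by (intro image_eqI[of _ _ "us @ vs"]) (auto simp: word_prod_append lists_gens_mono)
  qed
next
  fix w assume "w \<in> word_prod W ` lists J"
  then obtain ws where "ws \<in> lists J" "w = word_prod W ws" by auto
  then show "w \<in> generate W J"
    by (induction ws arbitrary: w) (auto intro: generate.intros)
qed

lemma generate_singleton:
  assumes "s \<in> S"
  shows "generate W {s} = {\<one>, s}"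
proof (intro equalityI subsetI)
  fix w assume "w \<in> generate W {s}"
  then show "w \<in> {\<one>, s}" using assms by induction auto
qed (auto intro: generate.intros)

lemma generate_closed: "J \<subseteq> S \<Longrightarrow> w \<in> generate W J \<Longrightarrow> w \<in> carrier W"
  using generate_in_carrier[of J w] gens_closed by auto

lemma subgroup_generate: "J \<subseteq> S \<Longrightarrow> subgroup (generate W J) W"
  using generate_is_subgroup[of J] gens_closed by auto

lemma ex_word: "w \<in> carrier W \<Longrightarrow> \<exists>ws\<in>lists S. word_prod W ws = w"
  using generate_words[OF subset_refl] gens_generate by auto

lemma ex_reduced:
  assumes "w \<in> carrier W"
  shows "\<exists>ws. is_reduced W S w ws"
proof -
  have "\<exists>n. \<exists>ws\<in>lists S. length ws = n \<and> word_prod W ws = w"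
    using ex_word[OF assms] by auto
  from LeastI_ex[OF this] show ?thesis
    unfolding is_reduced_def cox_length_def by auto
qed

lemma len_le: "ws \<in> lists S \<Longrightarrow> len (word_prod W ws) \<le> length ws"
  unfolding cox_length_def by (rule Least_le) auto

lemma len_one [simp]: "len \<one> = 0"
  using len_le[of "[]"] by simp

lemma len_eq_0:
  assumes "w \<in> carrier W"
  shows "len w = 0 \<longleftrightarrow> w = \<one>"
  using ex_reduced[OF assms] by (auto simp: is_reduced_def)

lemma len_mult_le:
  assumes "v \<in> carrier W" "w \<in> carrier W"
  shows "len (v \<otimes> w) \<le> len v + len w"
proof -
  obtain us vs where "is_reduced W S v us" "is_reduced W S w vs"
    using ex_reduced assms by meson
  then show ?thesis
    using len_le[of "us @ vs"] by (auto simp: is_reduced_def word_prod_append)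
qed

lemma len_inv:
  assumes "w \<in> carrier W"
  shows "len (inv w) = len w"
proof -
  have "len (inv v) \<le> len v" if v: "v \<in> carrier W" for v
  proof -
    obtain ws where "is_reduced W S v ws" using ex_reduced v by meson
    then show ?thesis using len_le[of "rev ws"] word_prod_rev[of ws] by (auto simp: is_reduced_def in_lists_conv_set)
  qed
  from this[of w] this[of "inv w"] show ?thesis using assms by simp
qed

section \<open>Reflection parity, exchange and folding\<close>

lemma refl_count_append:
  assumes "us \<in> lists S" "x \<in> carrier W"
  shows "refl_count W (us @ vs) x =
    refl_count W us x + refl_count W vs (inv (word_prod W us) \<otimes> x \<otimes> word_prod W us)"
  using assms
proof (induction us arbitrary: x rule: list.induct)
  case Nil
  then show ?case by simp
next
  case (Cons s us)
  then show ?case by (auto simp: inv_mult_group m_assoc)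
qed

text \<open>If \<open>x\<close> is the reflection \<open>s_1 ... s_i ... s_1\<close>, left
  multiplication by \<open>x\<close> cancels against the first letters of the word and deletes
  exactly \<open>s_i\<close>. The induction follows \<open>refl_count\<close> in conjugating
  \<open>x\<close> by each letter passed.\<close>

lemma refl_count_delete:
  assumes "ws \<in> lists S" "x \<in> carrier W" "refl_count W ws x > 0"
  shows "\<exists>us s vs. ws = us @ s # vs \<and> x \<otimes> word_prod W ws = word_prod W (us @ vs)"
  using assms
proof (induction ws arbitrary: x rule: list.induct)
  case Nil
  then show ?case by simp
next
  case (Cons s ws)
  have s: "s \<in> S" and ws: "ws \<in> lists S" using Cons.prems(1) by simp_all
  show ?case
  proof (cases "x = s")
    case True
    then have "s # ws = [] @ s # ws \<and> x \<otimes> word_prod W (s # ws) = word_prod W ([] @ ws)"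
      using s ws by simp
    then show ?thesis by blast
  next
    case False
    then obtain us t vs where *: "ws = us @ t # vs"
      "s \<otimes> x \<otimes> s \<otimes> word_prod W ws = word_prod W (us @ vs)"
      using Cons.IH[of "s \<otimes> x \<otimes> s"] Cons.prems s ws by auto
    have "x \<otimes> word_prod W (s # ws) = s \<otimes> (s \<otimes> x \<otimes> s \<otimes> word_prod W ws)"
      using s ws Cons.prems by (simp add: m_assoc)
    then have "s # ws = (s # us) @ t # vs \<and> x \<otimes> word_prod W (s # ws) = word_prod W ((s # us) @ vs)"
      using * by simp
    then show ?thesis by blast
  qed
qed

text \<open>The prefix of length \<open>j + 1\<close> of the alternating word contributes the
  palindrome of length \<open>2 * j + 1\<close>, which is \<open>(s t)^j s\<close>. Fact 2 says that
  peeling off two letters shifts the exponent by two.\<close>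

lemma refl_count_relator:
  assumes s: "s \<in> S" and t: "t \<in> S" and x: "x \<in> carrier W"
  shows "refl_count W (concat (replicate k [s, t])) x =
    (\<Sum>j<2 * k. of_bool (x = (s \<otimes> t) [^] j \<otimes> s))"
  using x
proof (induction k arbitrary: x)
  case 0
  then show ?case by simp
next
  case (Suc k)
  let ?r = "s \<otimes> t"
  have 1: "s \<otimes> x \<otimes> s = t \<longleftrightarrow> x = ?r [^] (1::nat) \<otimes> s"
  proof -
    have "s \<otimes> x \<otimes> s = t \<longleftrightarrow> s \<otimes> (s \<otimes> x \<otimes> s) \<otimes> s = s \<otimes> t \<otimes> s"
      using s t Suc.prems by simp
    also have "s \<otimes> (s \<otimes> x \<otimes> s) \<otimes> s = x"
      using s Suc.prems by (simp add: m_assoc)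
    finally show ?thesis using s t by simp
  qed
  have 2: "t \<otimes> (s \<otimes> x \<otimes> s) \<otimes> t = ?r [^] j \<otimes> s \<longleftrightarrow> x = ?r [^] (Suc (Suc j)) \<otimes> s" for j :: nat
  proof -
    have p: "?r [^] j \<in> carrier W" using s t by simp
    have "t \<otimes> (s \<otimes> x \<otimes> s) \<otimes> t = ?r [^] j \<otimes> s \<longleftrightarrow>
      s \<otimes> (t \<otimes> (t \<otimes> (s \<otimes> x \<otimes> s) \<otimes> t)) \<otimes> t \<otimes> s = s \<otimes> (t \<otimes> (?r [^] j \<otimes> s)) \<otimes> t \<otimes> s"
      using s t Suc.prems p by simp
    also have "s \<otimes> (t \<otimes> (t \<otimes> (s \<otimes> x \<otimes> s) \<otimes> t)) \<otimes> t \<otimes> s = x"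
      using s t Suc.prems by (simp add: m_assoc)
    also have "s \<otimes> (t \<otimes> (?r [^] j \<otimes> s)) \<otimes> t \<otimes> s = (?r \<otimes> ?r [^] j) \<otimes> ?r \<otimes> s"
      using s t p by (simp add: m_assoc)
    also have "?r \<otimes> ?r [^] j = ?r [^] Suc j"
      using s t nat_pow_Suc2[of ?r j] by simp
    finally show ?thesis using s t p by simp
  qed
  have "refl_count W (concat (replicate (Suc k) [s, t])) x =
     of_bool (x = s) + (of_bool (s \<otimes> x \<otimes> s = t) +
       (\<Sum>j<2 * k. of_bool (t \<otimes> (s \<otimes> x \<otimes> s) \<otimes> t = ?r [^] j \<otimes> s)))"
    using Suc s t by simp
  also have "\<dots> = of_bool (x = ?r [^] (0::nat) \<otimes> s) + (of_bool (x = ?r [^] (Suc 0) \<otimes> s) +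
       (\<Sum>j<2 * k. of_bool (x = ?r [^] (Suc (Suc j)) \<otimes> s)))"
    unfolding 1 2 using s by simp
  also have "\<dots> = (\<Sum>j<2 * Suc k. of_bool (x = ?r [^] j \<otimes> s))"
    by (simp only: mult_Suc_right add_2_eq_Suc sum.lessThan_Suc_shift)
  finally show ?case .
qed

text \<open>The powers of \<open>s t\<close> have period \<open>m\<close>, so the
  \<open>2 * m\<close> reflections of the relator form two equal halves. For infinite order
  \<open>m = 0\<close> and the relator is empty.\<close>

lemma even_refl_count_relator:
  assumes s: "s \<in> S" and t: "t \<in> S" and x: "x \<in> carrier W"
  shows "even (refl_count W (concat (replicate (coxeter_entry W s t) [s, t])) x)"
proof -
  define m where "m = coxeter_entry W s t"
  define f where "f j = (of_bool (x = (s \<otimes> t) [^] j \<otimes> s) :: nat)" for j :: nat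
  have "(s \<otimes> t) [^] m = \<one>"
    unfolding m_def coxeter_entry_def using s t by (intro pow_ord_eq_1) auto
  then have per: "f (j + m) = f j" for j
    using s t by (simp add: f_def flip: nat_pow_mult)
  have "(\<Sum>j<2 * m. f j) = (\<Sum>j<m. f j) + (\<Sum>j<m. f (j + m))"
    using sum.atLeastLessThan_concat[of 0 m "2 * m" f] sum.shift_bounds_nat_ivl[of f 0 m m]
    by (simp add: mult_2 flip: atLeast0LessThan)
  then show ?thesis
    using refl_count_relator[OF s t x, of m] per
    by (simp add: f_def m_def flip: mult_2 del: sum_of_bool_eq)
qed

lemma word_prod_relator:
  assumes s: "s \<in> S" and t: "t \<in> S"
  shows "word_prod W (concat (replicate (coxeter_entry W s t) [s, t])) = \<one>"
proof -
  have "word_prod W (concat (replicate k [s, t])) = (s \<otimes> t) [^] k" for k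
      proof (induction k)
    case (Suc k)
    have "(s \<otimes> t) [^] Suc k = (s \<otimes> t) \<otimes> (s \<otimes> t) [^] k"
      using s t by (intro nat_pow_Suc2) simp
    then show ?case using Suc s t by (simp add: m_assoc del: nat_pow_Suc)
  qed simp
  then show ?thesis
    using s t pow_ord_eq_1[of "s \<otimes> t"] by (simp add: coxeter_entry_def)
qed

lemma coxeter_equiv_lists:
  "coxeter_equiv S (coxeter_entry W) us vs \<Longrightarrow> us \<in> lists S \<longleftrightarrow> vs \<in> lists S"
  by (induction rule: coxeter_equiv.induct) (auto split: if_splits)

text \<open>A relator has product one, so inserting it leaves the reflections of the word after it
  unchanged; its own reflections contribute evenly at every \<open>x\<close>.\<close>

lemma coxeter_equiv_even:
  assumes "coxeter_equiv S (coxeter_entry W) us vs" "us \<in> lists S" "x \<in> carrier W"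
  shows "even (length us) = even (length vs) \<and>
    even (refl_count W us x) = even (refl_count W vs x)"
  using assms
proof (induction rule: coxeter_equiv.induct)
  case (refl u)
  then show ?case by simp
next
  case (sym u v)
  then show ?case using coxeter_equiv_lists by blast
next
  case (trans u v w)
  then show ?case using coxeter_equiv_lists by blast
next
  case (relator s t u v)
  let ?r = "concat (replicate (coxeter_entry W s t) [s, t])"
  have r: "?r \<in> lists S" using relator by (auto split: if_splits)
  have u: "u \<in> lists S" using relator by auto
  let ?y = "inv (word_prod W u) \<otimes> x \<otimes> word_prod W u"
  have "refl_count W (u @ ?r @ v) x =
      refl_count W u x + (refl_count W ?r ?y + refl_count W v ?y)"
    using r u relator word_prod_relator[of s t] by (simp add: refl_count_append)
  moreover have "even (refl_count W ?r ?y)"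
    using even_refl_count_relator relator u by simp
  moreover have "even (length ?r)"
    by (simp add: length_concat sum_list_replicate)
  ultimately show ?case
    using relator u by (simp add: refl_count_append)
qed

text \<open>The axiom \<open>presentation\<close> speaks only of words with product one. Appending
  \<open>rev vs\<close> to \<open>us\<close> and to \<open>vs\<close> yields two such words with a
  common tail, and their parities can then be compared.\<close>

lemma word_even:
  assumes "us \<in> lists S" "vs \<in> lists S" "word_prod W us = word_prod W vs" "x \<in> carrier W"
  shows "even (length us) = even (length vs)"
    and "even (refl_count W us x) = even (refl_count W vs x)"
proof -
  have *: "even (length (ws @ rev vs)) \<and> even (refl_count W (ws @ rev vs) x)"
    if "ws \<in> lists S" "word_prod W ws = word_prod W vs" for ws
  proof -
    have "ws @ rev vs \<in> lists S" using that assms by auto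
    moreover from this have "coxeter_equiv S (coxeter_entry W) (ws @ rev vs) []"
      using that assms by (intro presentation) (auto simp: word_prod_append word_prod_rev)
    ultimately show ?thesis using coxeter_equiv_even assms by fastforce
  qed
  show "even (length us) = even (length vs)"
    using *[of us] assms by auto
  show "even (refl_count W us x) = even (refl_count W vs x)"
    using *[of us] *[of vs] assms by (auto simp: refl_count_append)
qed

lemma even_len_word: "ws \<in> lists S \<Longrightarrow> even (len (word_prod W ws)) = even (length ws)"
  using ex_reduced[of "word_prod W ws"] word_even(1)[of _ ws \<one>]
  by (metis is_reduced_def one_closed word_prod_closed)

lemma even_len_mult:
  assumes "v \<in> carrier W" "w \<in> carrier W"
  shows "even (len (v \<otimes> w)) = even (len v + len w)"
proof -
  obtain us vs where "is_reduced W S v us" "is_reduced W S w vs"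
    using ex_reduced assms by meson
  then show ?thesis
    using even_len_word[of "us @ vs"] by (auto simp: is_reduced_def word_prod_append)
qed

lemma len_gen [simp]: "s \<in> S \<Longrightarrow> len s = 1"
  using len_le[of "[s]"] len_eq_0[of s] gen_not_one[of s] by fastforce

lemma len_gen_mult:
  assumes "s \<in> S" "w \<in> carrier W"
  shows "len (s \<otimes> w) = len w + 1 \<or> len w = len (s \<otimes> w) + 1"
proof -
  have "len (s \<otimes> w) \<le> len w + 1" "len w \<le> len (s \<otimes> w) + 1"
    using len_mult_le[of s w] len_mult_le[of s "s \<otimes> w"] assms by auto
  moreover have "even (len (s \<otimes> w)) \<noteq> even (len w)"
    using even_len_mult[of s w] assms by auto
  ultimately show ?thesis
    by (metis Suc_eq_plus1 le_SucE le_antisym)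
qed

lemma len_mult_gen:
  assumes "s \<in> S" "w \<in> carrier W"
  shows "len (w \<otimes> s) = len w + 1 \<or> len w = len (w \<otimes> s) + 1"
  using len_gen_mult[of s "inv w"] len_inv[of "w \<otimes> s"] len_inv[of w] assms
  by (simp add: inv_mult_group)

text \<open>A reduced word \<open>vs\<close> of \<open>s w\<close> does not count \<open>s\<close>:
  otherwise deletion would give \<open>w\<close> a word shorter than \<open>s w\<close>. Hence
  \<open>s # vs\<close>, a word for \<open>w\<close>, counts \<open>s\<close> exactly once, and by
  parity \<open>ws\<close> counts it an odd, hence positive, number of times.\<close>

lemma exchange:
  assumes s: "s \<in> S" and ws: "ws \<in> lists S"
    and less: "len (s \<otimes> word_prod W ws) < len (word_prod W ws)"
  shows "\<exists>us t vs. ws = us @ t # vs \<and> s \<otimes> word_prod W ws = word_prod W (us @ vs)"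
proof -
  let ?w = "word_prod W ws"
  obtain vs where vs: "is_reduced W S (s \<otimes> ?w) vs"
    using ex_reduced s ws by (meson gen_closed m_closed word_prod_closed)
  then have vsS: "vs \<in> lists S" and pv: "word_prod W vs = s \<otimes> ?w"
    and lv: "length vs = len (s \<otimes> ?w)"
    by (auto simp: is_reduced_def)
  have "refl_count W vs s = 0"
  proof (rule ccontr)
    assume "refl_count W vs s \<noteq> 0"
    then obtain a b c where "vs = a @ b # c" "s \<otimes> word_prod W vs = word_prod W (a @ c)"
      using refl_count_delete[of vs s] vsS s by auto
    then have "len ?w < length vs"
      using len_le[of "a @ c"] vsS pv s ws by auto
    then show False using less lv by simp
  qed
  then have "odd (refl_count W (s # vs) s)" using s by simp
  moreover have "word_prod W (s # vs) = ?w" using pv s ws by simp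
  ultimately have "odd (refl_count W ws s)"
    using word_even(2)[of "s # vs" ws s] s vsS ws by auto
  then show ?thesis
    using refl_count_delete[of ws s] s ws by (meson gen_closed odd_pos)
qed

text \<open>Exchange is applied to a reduced word of \<open>u\<close> followed by \<open>t\<close>.
  Deleting the last letter gives \<open>s u t = u\<close>; deleting an earlier one would make
  \<open>s u\<close> shorter than \<open>u\<close>.\<close>

lemma folding:
  assumes s: "s \<in> S" and t: "t \<in> S" and u: "u \<in> carrier W"
    and su: "len (s \<otimes> u) = len u + 1" and ut: "len (u \<otimes> t) = len u + 1"
  shows "len (s \<otimes> u \<otimes> t) = len u + 2 \<or> s \<otimes> u \<otimes> t = u"
proof (rule disjCI)
  assume ne: "s \<otimes> u \<otimes> t \<noteq> u"
  obtain ws where "is_reduced W S u ws" using ex_reduced u by meson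
  then have ws: "ws \<in> lists S" "word_prod W ws = u" "length ws = len u"
    by (auto simp: is_reduced_def)
  have wt: "word_prod W (ws @ [t]) = u \<otimes> t" using ws t by (simp add: word_prod_append)
  show "len (s \<otimes> u \<otimes> t) = len u + 2"
  proof (rule ccontr)
    assume "len (s \<otimes> u \<otimes> t) \<noteq> len u + 2"
    then have "len (s \<otimes> (u \<otimes> t)) < len (u \<otimes> t)"
      using len_gen_mult[of s "u \<otimes> t"] s t u ut by (auto simp: m_assoc)
    then obtain a b c where abc: "ws @ [t] = a @ b # c" "s \<otimes> (u \<otimes> t) = word_prod W (a @ c)"
      using exchange[of s "ws @ [t]"] s t ws wt by auto
    show False
    proof (cases c rule: rev_cases)
      case Nil
      then show False using abc ne ws s t u by (auto simp: m_assoc)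
    next
      case (snoc c' y)
      then have "ws = a @ b # c'" "y = t" using abc by auto
      then have "s \<otimes> u \<otimes> t = word_prod W (a @ c') \<otimes> t"
        using abc snoc s t u ws word_prod_append[of "a @ c'" "[t]"] by (simp add: m_assoc)
      then have "s \<otimes> u = word_prod W (a @ c')"
        using s t u ws \<open>ws = a @ b # c'\<close> by auto
      then show False
        using len_le[of "a @ c'"] \<open>ws = a @ b # c'\<close> ws su by auto
    qed
  qed
qed

text \<open>Reduces to \<open>folding\<close> at \<open>s w\<close>. If \<open>t\<close> lengthens
  \<open>s w\<close>, folding leaves only \<open>w t = s w\<close>, because \<open>w t\<close> is
  shorter than \<open>w\<close>.\<close>

lemma folding_down:
  assumes s: "s \<in> S" and t: "t \<in> S" and w: "w \<in> carrier W"
    and sw: "len w = len (s \<otimes> w) + 1" and wt: "len w = len (w \<otimes> t) + 1"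
  shows "len w = len (s \<otimes> w \<otimes> t) + 2 \<or> s \<otimes> w \<otimes> t = w"
proof -
  let ?y = "s \<otimes> w"
  have y: "?y \<in> carrier W" "s \<otimes> ?y = w" using s w by auto
  consider "len (?y \<otimes> t) = len ?y + 1" | "len ?y = len (?y \<otimes> t) + 1"
    using len_mult_gen[of t ?y] t y by auto
  then show ?thesis
  proof cases
    case 1
    then have "len (s \<otimes> ?y \<otimes> t) = len ?y + 2 \<or> s \<otimes> ?y \<otimes> t = ?y"
      using folding[OF s t y(1)] y(2) sw by auto
    then have "w \<otimes> t = ?y" using y sw wt by auto
    then have "w = ?y \<otimes> t" using t w by (metis gen_cancel_right)
    then show ?thesis by simp
  next
    case 2
    then show ?thesis using sw by simp
  qed
qed

section \<open>Standard parabolic subgroups\<close>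

lemma ex_reduced_parabolic:
  assumes "J \<subseteq> S" "w \<in> generate W J"
  shows "\<exists>ws\<in>lists J. is_reduced W S w ws"
proof -
  have "\<exists>vs\<in>lists J. is_reduced W S (word_prod W ws) vs" if "ws \<in> lists J" for ws
    using that
  proof (induction ws rule: list.induct)
    case Nil
    show ?case by (rule bexI[of _ "[]"]) (auto simp: is_reduced_def)
  next
    case (Cons s ws)
    then obtain vs where vs: "vs \<in> lists J" "is_reduced W S (word_prod W ws) vs" by auto
    then have v: "vs \<in> lists S" "word_prod W ws = word_prod W vs" "length vs = len (word_prod W vs)"
      by (auto simp: is_reduced_def)
    have s: "s \<in> J" "s \<in> S" using Cons.prems(1) assms(1) by auto
    consider "len (s \<otimes> word_prod W vs) = len (word_prod W vs) + 1"
      | "len (word_prod W vs) = len (s \<otimes> word_prod W vs) + 1"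
      using len_gen_mult[of s "word_prod W vs"] v s by auto
    then show ?case
    proof cases
      case 1
      then have "is_reduced W S (word_prod W (s # ws)) (s # vs)"
        using v s by (auto simp: is_reduced_def)
      then show ?thesis using vs s by (meson Cons_in_lists_iff)
    next
      case 2
      \<comment> \<open>Exchange only deletes letters, so the shorter word is still a word in
        \<open>J\<close>.\<close>
      then obtain a b c where abc: "vs = a @ b # c" "s \<otimes> word_prod W vs = word_prod W (a @ c)"
        using exchange[of s vs] v s by auto
      then have "is_reduced W S (word_prod W (s # ws)) (a @ c)"
        using v 2 by (auto simp: is_reduced_def)
      moreover have "a @ c \<in> lists J" using abc vs by auto
      ultimately show ?thesis by blast
    qed
  qed
  then show ?thesis using generate_words[OF assms(1)] assms(2) by auto
qed

lemma gen_in_parabolic: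
  assumes "J \<subseteq> S" "s \<in> S" "s \<in> generate W J"
  shows "s \<in> J"
proof -
  obtain ws where ws: "ws \<in> lists J" "is_reduced W S s ws"
    using ex_reduced_parabolic assms by blast
  then obtain t where "ws = [t]" using assms by (auto simp: is_reduced_def length_Suc_conv)
  then show ?thesis using ws assms by (auto simp: is_reduced_def)
qed

text \<open>Exchange turns a word in \<open>J\<close> for \<open>w\<close> into a word in
  \<open>J\<close> for \<open>s w\<close>, so the parabolic subgroup also contains \<open>s\<close>
  as the product of \<open>s w\<close> and \<open>inv w\<close>.\<close>

lemma parabolic_descent:
  assumes J: "J \<subseteq> S" and s: "s \<in> S" and w: "w \<in> generate W J" and less: "len (s \<otimes> w) < len w"
  shows "s \<in> J" "s \<otimes> w \<in> generate W J"
proof -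
  obtain vs where vs: "vs \<in> lists J" "w = word_prod W vs"
    using w generate_words[OF J] by auto
  then obtain a b c where "vs = a @ b # c" "s \<otimes> w = word_prod W (a @ c)"
    using exchange[of s vs] less s J lists_gens_mono by metis
  then show swJ: "s \<otimes> w \<in> generate W J"
    using vs generate_words[OF J] by auto
  have wS: "w \<in> carrier W" using generate_closed[OF J w] .
  have "(s \<otimes> w) \<otimes> inv w \<in> generate W J"
    using subgroup_generate[OF J] w swJ by (meson subgroup.m_closed subgroup.m_inv_closed)
  then have "s \<in> generate W J" using s wS by (simp add: m_assoc)
  then show "s \<in> J" using gen_in_parabolic J s by blast
qed

lemma reduced_parabolic:
  assumes "J \<subseteq> S" "w \<in> generate W J" "is_reduced W S w ws"
  shows "ws \<in> lists J"
  using assms(2,3)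
proof (induction ws arbitrary: w rule: list.induct)
  case Nil
  then show ?case by simp
next
  case (Cons s ws)
  have s: "s \<in> S" and ws: "ws \<in> lists S" and w: "w = s \<otimes> word_prod W ws"
    and l: "len w = Suc (length ws)"
    using Cons.prems by (auto simp: is_reduced_def)
  have sw: "s \<otimes> w = word_prod W ws" using s ws w by simp
  have red: "is_reduced W S (s \<otimes> w) ws"
    using len_le[OF ws] len_gen_mult[of s w] s ws w sw l by (auto simp: is_reduced_def)
  then have "len (s \<otimes> w) < len w" using l by (simp add: is_reduced_def)
  then show ?case
    using parabolic_descent[OF assms(1) s Cons.prems(1)] Cons.IH[OF _ red] by simp
qed

text \<open>A single reduced word of \<open>w\<close> suffices: by \<open>reduced_parabolic\<close>
  its letters lie in \<open>J\<close> as well as in \<open>K\<close>.\<close>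

lemma parabolic_Int:
  assumes "J \<subseteq> S" "K \<subseteq> S"
  shows "generate W J \<inter> generate W K = generate W (J \<inter> K)"
proof (intro equalityI subsetI)
  fix w assume w: "w \<in> generate W J \<inter> generate W K"
  then have "w \<in> carrier W" using generate_closed[OF assms(1)] by simp
  then obtain ws where ws: "is_reduced W S w ws"
    using ex_reduced by metis
  have "ws \<in> lists J" by (rule reduced_parabolic[OF assms(1) _ ws]) (use w in blast)
  moreover have "ws \<in> lists K" by (rule reduced_parabolic[OF assms(2) _ ws]) (use w in blast)
  ultimately have "ws \<in> lists (J \<inter> K)" by (rule lists_IntI)
  moreover have "generate W (J \<inter> K) = word_prod W ` lists (J \<inter> K)"
    using assms by (intro generate_words) blast
  ultimately show "w \<in> generate W (J \<inter> K)"
    using ws by (auto simp: is_reduced_def)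
next
  fix w assume w: "w \<in> generate W (J \<inter> K)"
  have "generate W (J \<inter> K) \<subseteq> generate W J" "generate W (J \<inter> K) \<subseteq> generate W K"
    by (rule mono_generate, simp)+
  then show "w \<in> generate W J \<inter> generate W K" using w by blast
qed

section \<open>Elements of maximal length\<close>

lemma max_len_split:
  assumes J: "J \<subseteq> S" and w: "w \<in> generate W J"
    and max: "\<And>v. v \<in> generate W J \<Longrightarrow> len v \<le> len w"
    and x: "x \<in> generate W J"
  shows "len w = len x + len (inv x \<otimes> w)"
proof -
  have wW: "w \<in> carrier W" using generate_closed J w by blast
  have desc: "len w = len (s \<otimes> w) + 1" if "s \<in> J" for s
  proof -
    have "s \<otimes> w \<in> generate W J" by (rule generate.eng[OF generate.incl[OF that] w])
    then show ?thesis using max[of "s \<otimes> w"] len_gen_mult[of s w] that J wW by auto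
  qed
  \<comment> \<open>Induction over the suffixes \<open>ws\<close> of a reduced word of
    \<open>x\<close>. The next letter \<open>s\<close> shortens \<open>w\<close> from the left
    because \<open>w\<close> has maximal length.\<close>
  have main: "len w = len (word_prod W ws) + len (inv (word_prod W ws) \<otimes> w)"
    if "ws \<in> lists J" "length ws = len (word_prod W ws)" for ws
    using that
  proof (induction ws rule: list.induct)
    case Nil
    then show ?case using wW by simp
  next
    case (Cons s ws)
    have s: "s \<in> J" "s \<in> S" and wsJ: "ws \<in> lists J" and ws: "ws \<in> lists S"
      using Cons.prems J by auto
    let ?x = "word_prod W ws"
    have lx: "length ws = len ?x" "len (s \<otimes> ?x) = len ?x + 1"
      using Cons.prems(2) len_le[OF ws] len_gen_mult[of s ?x] s ws by auto
    let ?y = "inv ?x \<otimes> w"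
    have y: "?y \<in> carrier W" "w = ?x \<otimes> ?y" using ws wW by (auto simp flip: m_assoc)
    obtain vs where "is_reduced W S ?y vs" using ex_reduced y by meson
    then have vs: "vs \<in> lists S" "word_prod W vs = ?y" "length vs = len ?y"
      by (auto simp: is_reduced_def)
    have wv: "w = word_prod W (ws @ vs)" using ws vs y by (simp add: word_prod_append)
    obtain a b c where abc: "ws @ vs = a @ b # c" "s \<otimes> w = word_prod W (a @ c)"
      using exchange[of s "ws @ vs"] desc[OF s(1)] ws vs wv s by auto
    \<comment> \<open>A letter deleted inside \<open>ws\<close> would contradict that
      \<open>s # ws\<close> is reduced. So it comes from \<open>vs\<close>, which makes
      \<open>inv (s x) w\<close> shorter than \<open>inv x w\<close>; subadditivity of length then
      leaves only equality.\<close>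
    consider c' where "ws = a @ b # c'" "c = c' @ vs" | a' where "a = ws @ a'" "vs = a' @ b # c"
      using abc(1) by (auto simp: append_eq_append_conv2 append_eq_Cons_conv)
    then show ?case
    proof cases
      case 1
      then have "s \<otimes> w = word_prod W (a @ c') \<otimes> ?y"
        using abc vs ws word_prod_append[of "a @ c'" vs] by auto
      then have "s \<otimes> ?x \<otimes> ?y = word_prod W (a @ c') \<otimes> ?y"
        using y s ws by (metis gen_closed m_assoc word_prod_closed)
      then have "s \<otimes> ?x = word_prod W (a @ c')"
        using y s ws 1 by auto
      then show ?thesis using len_le[of "a @ c'"] 1 lx ws by auto
    next
      case 2
      then have sw: "s \<otimes> w = ?x \<otimes> word_prod W (a' @ c)"
        using abc vs ws by (auto simp: word_prod_append)
      have ac: "a' @ c \<in> lists S" "length (a' @ c) + 1 = len ?y" using 2 vs by auto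
      have "w = s \<otimes> (s \<otimes> w)" using s wW by simp
      also have "\<dots> = s \<otimes> ?x \<otimes> word_prod W (a' @ c)"
        unfolding sw using s ws ac by (simp only: m_assoc gen_closed word_prod_closed)
      finally have weq: "w = s \<otimes> ?x \<otimes> word_prod W (a' @ c)" .
      have "inv (s \<otimes> ?x) \<otimes> w = word_prod W (a' @ c)"
        using weq s ws ac by (metis gen_closed inv_solve_left m_closed word_prod_closed)
      then have "len (inv (s \<otimes> ?x) \<otimes> w) + 1 \<le> len ?y" using len_le[OF ac(1)] ac(2) by simp
      moreover have "len w \<le> len (s \<otimes> ?x) + len (inv (s \<otimes> ?x) \<otimes> w)"
        using len_mult_le[of "s \<otimes> ?x" "inv (s \<otimes> ?x) \<otimes> w"] s ws wW
        by (simp flip: m_assoc)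
      ultimately show ?thesis using Cons.IH[OF wsJ lx(1)] lx by simp
    qed
  qed
  obtain ws where "ws \<in> lists J" "is_reduced W S x ws"
    using ex_reduced_parabolic J x by blast
  then have ws: "ws \<in> lists J" "length ws = len (word_prod W ws)" and x: "word_prod W ws = x"
    by (auto simp: is_reduced_def)
  from main[OF ws] show ?thesis unfolding x .
qed

text \<open>Justifies the \<open>THE\<close> in \<open>longest_elt\<close>: for two elements
  \<open>x\<close>, \<open>w\<close> of maximal length, \<open>max_len_split\<close> gives
  \<open>inv x w\<close> length zero.\<close>

lemma longest_elt_props:
  assumes J: "J \<subseteq> S" and fin: "finite (generate W J)"
  shows "longest_elt W S J \<in> generate W J"
    and "\<And>v. v \<in> generate W J \<Longrightarrow> len v \<le> len (longest_elt W S J)"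
proof -
  let ?P = "\<lambda>w. w \<in> generate W J \<and> (\<forall>v\<in>generate W J. len v \<le> len w)"
  have "Max (len ` generate W J) \<in> len ` generate W J"
    using fin generate.one[of W J] by (intro Max_in) auto
  then obtain w where w: "w \<in> generate W J" "len w = Max (len ` generate W J)" by auto
  then have Pw: "?P w" using fin by auto
  have "x = w" if "?P x" for x
  proof -
    have "len w = len x + len (inv x \<otimes> w)" "len x = len w"
      using max_len_split[OF J, of w x] Pw that by (auto intro: antisym)
    then have "inv x \<otimes> w = \<one>"
      using len_eq_0[of "inv x \<otimes> w"] generate_closed[OF J] Pw that by auto
    moreover have "x \<in> carrier W" "w \<in> carrier W"
      using generate_closed[OF J] Pw that by blast+
    moreover from this have "x \<otimes> (inv x \<otimes> w) = w" by (simp flip: m_assoc)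
    ultimately show ?thesis by simp
  qed
  then have "?P (longest_elt W S J)"
    unfolding longest_elt_def by (rule theI[of ?P w, OF Pw])
  then show "longest_elt W S J \<in> generate W J"
    and "\<And>v. v \<in> generate W J \<Longrightarrow> len v \<le> len (longest_elt W S J)" by auto
qed

lemma longest_elt_descents:
  assumes J: "J \<subseteq> S" and fin: "finite (generate W J)" and s: "s \<in> S"
  shows "len (s \<otimes> longest_elt W S J) < len (longest_elt W S J) \<longleftrightarrow> s \<in> J"
proof
  assume "s \<in> J"
  then have "s \<otimes> longest_elt W S J \<in> generate W J"
    using longest_elt_props[OF J fin] by (auto intro: generate.eng generate.incl)
  then show "len (s \<otimes> longest_elt W S J) < len (longest_elt W S J)"
    using longest_elt_props[OF J fin] len_gen_mult[of s "longest_elt W S J"] s generate_closed[OF J]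
    by fastforce
qed (use parabolic_descent[OF J s] longest_elt_props[OF J fin] in blast)

text \<open>With \<open>w\<close> the longest element, \<open>u = s w\<close> satisfies \<open>s u = w = u s'\<close> for \<open>s' = w\<inverse> s w\<close>,
  which is again a generator.\<close>

lemma longest_conj_gen:
  assumes fin: "finite (carrier W)" and s: "s \<in> S"
  defines "w \<equiv> longest_elt W S S"
  shows "inv w \<otimes> s \<otimes> w \<in> S" "len w = len (s \<otimes> w) + 1"
proof -
  note props = longest_elt_props[OF subset_refl, unfolded gens_generate, OF fin, folded w_def]
  note split = max_len_split[OF subset_refl, of w, unfolded gens_generate, OF props]
  have w: "w \<in> carrier W" using props by blast
  show lw: "len w = len (s \<otimes> w) + 1" using split[of s] s by simp
  have "len w = len (s \<otimes> w) + len (inv (s \<otimes> w) \<otimes> w)" using split[of "s \<otimes> w"] s w by simp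
  then have l: "len (inv w \<otimes> s \<otimes> w) = 1"
    using lw s w by (simp add: inv_mult_group)
  obtain ws where "is_reduced W S (inv w \<otimes> s \<otimes> w) ws" using ex_reduced s w by (meson gen_closed inv_closed m_closed)
  then show "inv w \<otimes> s \<otimes> w \<in> S"
    using l by (auto simp: is_reduced_def length_Suc_conv)
qed

end

section \<open>Weyl distances and regularity\<close>

context building
begin

abbreviation sphere :: "'c \<Rightarrow> 'a \<Rightarrow> 'c set" where
  "sphere C w \<equiv> {D \<in> Ch. \<delta> C D = w}"

abbreviation residue :: "'c \<Rightarrow> 'a set \<Rightarrow> 'c set" where
  "residue C K \<equiv> {D \<in> Ch. \<delta> C D \<in> generate W K}"

lemma dist_refl [simp]: "C \<in> Ch \<Longrightarrow> \<delta> C C = \<one>"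
  using WD1 by blast

section \<open>Symmetry of the Weyl distance and moves of either argument\<close>

lemma adjacent_sym:
  assumes "C \<in> Ch" "D \<in> Ch" "s \<in> S" "\<delta> C D = s"
  shows "\<delta> D C = s"
proof -
  have "\<one> \<in> {s \<otimes> \<delta> D C, \<delta> D C}"
    using WD2[of D C C s] assms by simp
  moreover have "\<delta> D C \<noteq> \<one>"
    using assms WD1[of C D] WD1[of D C] gen_not_one by auto
  ultimately have "s \<otimes> \<delta> D C = s \<otimes> s" using assms by auto
  then show ?thesis
    using assms dist_closed[of D C] by (metis gen_closed gen_cancel)
qed

lemma panel_adjacent:
  assumes "C \<in> Ch" "D \<in> Ch" "E \<in> Ch" "s \<in> S" "\<delta> C D = s" "\<delta> C E = s" "D \<noteq> E"
  shows "\<delta> D E = s"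
  using WD2[of C E D s] adjacent_sym[of C D s] WD1[of D E] assms by auto

lemma ex_step_left:
  assumes "C \<in> Ch" "D \<in> Ch" "s \<in> S"
  obtains C' where "C' \<in> Ch" "\<delta> C C' = s" "\<delta> C' D = s \<otimes> \<delta> C D"
  using WD3[OF assms] adjacent_sym assms by blast

lemma dist_step_left:
  assumes "C \<in> Ch" "D \<in> Ch" "C' \<in> Ch" "s \<in> S" "\<delta> C C' = s"
  shows "\<delta> C' D = s \<otimes> \<delta> C D \<or> \<delta> C' D = \<delta> C D"
  using WD2[of C D C' s] adjacent_sym[of C C' s] assms by auto

lemma dist_up_left:
  assumes "C \<in> Ch" "D \<in> Ch" "C' \<in> Ch" "s \<in> S" "\<delta> C C' = s"
    and "len (s \<otimes> \<delta> C D) = len (\<delta> C D) + 1"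
  shows "\<delta> C' D = s \<otimes> \<delta> C D"
  using WD2'[of C D C' s] adjacent_sym[of C C' s] assms by auto

text \<open>The axioms move only the first argument of \<delta>. Here \<open>C\<close> is walked
  towards \<open>D\<close> along a reduced word until it meets \<open>D\<close>, where the claim is
  \<open>\<delta> D D' = s\<close>. Each step back is upward because \<open>t y s\<close> is longer
  than \<open>y\<close> by two.\<close>

lemma dist_up_right:
  assumes "C \<in> Ch" "D \<in> Ch" "D' \<in> Ch" "s \<in> S" "\<delta> D D' = s"
    and "len (\<delta> C D \<otimes> s) = len (\<delta> C D) + 1"
  shows "\<delta> C D' = \<delta> C D \<otimes> s"
proof -
  have "\<delta> C D' = word_prod W ws \<otimes> s"
    if "C \<in> Ch" "is_reduced W S (\<delta> C D) ws" "len (\<delta> C D \<otimes> s) = len (\<delta> C D) + 1" for ws C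
    using that
  proof (induction ws arbitrary: C rule: list.induct)
    case Nil
    then show ?case using assms WD1[of C D] by (simp add: is_reduced_def)
  next
    case (Cons t ws)
    have t: "t \<in> S" and ws: "ws \<in> lists S" and w: "\<delta> C D = t \<otimes> word_prod W ws"
      and l: "len (\<delta> C D) = Suc (length ws)"
      using Cons.prems(2) by (auto simp: is_reduced_def)
    let ?y = "word_prod W ws"
    have y: "?y \<in> carrier W" using ws by blast
    obtain C' where C': "C' \<in> Ch" "\<delta> C C' = t" "\<delta> C' D = t \<otimes> \<delta> C D"
      using ex_step_left[of C D t] Cons.prems(1) assms(2) t by blast
    have yD: "\<delta> C' D = ?y" using C' w t y by simp
    have ly: "len ?y = length ws"
      using len_le[OF ws] len_gen_mult[OF t y] w l by auto
    have "len (t \<otimes> (?y \<otimes> s)) = len ?y + 2"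
      using Cons.prems(3) l ly w t y assms(4) by (simp add: m_assoc)
    moreover have "?y \<otimes> s \<in> carrier W" using y assms(4) by blast
    ultimately have lys: "len (?y \<otimes> s) = len ?y + 1" "len (t \<otimes> (?y \<otimes> s)) = len (?y \<otimes> s) + 1"
      using len_mult_gen[OF assms(4) y] len_gen_mult[OF t, of "?y \<otimes> s"] by arith+
    have "\<delta> C' D' = ?y \<otimes> s"
      using C'(1) yD ws ly lys(1) by (intro Cons.IH) (auto simp: is_reduced_def)
    then have "\<delta> C D' = t \<otimes> (?y \<otimes> s)"
      using dist_up_left[of C' D' C t] C' lys adjacent_sym[of C C' t] Cons.prems(1) assms(3) t by simp
    then show ?case using t y assms(4) by (simp add: m_assoc)
  qed
  moreover obtain ws where "is_reduced W S (\<delta> C D) ws"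
    using ex_reduced dist_closed assms by meson
  ultimately show ?thesis using assms by (auto simp: is_reduced_def)
qed

text \<open>The path from \<open>C\<close> to \<open>D\<close> is reversed one step at a time. An
  inverse has the same length, so every reversed step lengthens the distance and
  \<open>dist_up_right\<close> applies.\<close>

lemma dist_sym:
  assumes "C \<in> Ch" "D \<in> Ch"
  shows "\<delta> D C = inv (\<delta> C D)"
proof -
  have "\<delta> D C = inv (word_prod W ws)" if "C \<in> Ch" "is_reduced W S (\<delta> C D) ws" for ws C
    using that
  proof (induction ws arbitrary: C rule: list.induct)
    case Nil
    then show ?case using assms WD1[of C D] by (simp add: is_reduced_def)
  next
    case (Cons s ws)
    have s: "s \<in> S" and ws: "ws \<in> lists S" and w: "\<delta> C D = s \<otimes> word_prod W ws"
      and l: "len (\<delta> C D) = Suc (length ws)"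
      using Cons.prems(2) by (auto simp: is_reduced_def)
    let ?y = "word_prod W ws"
    have y: "?y \<in> carrier W" using ws by blast
    obtain C' where C': "C' \<in> Ch" "\<delta> C C' = s" "\<delta> C' D = s \<otimes> \<delta> C D"
      using ex_step_left[of C D s] Cons.prems(1) assms(2) s by blast
    have yD: "\<delta> C' D = ?y" using C' w s y by simp
    have ly: "len ?y = length ws"
      using len_le[OF ws] len_gen_mult[OF s y] w l by auto
    have DC': "\<delta> D C' = inv ?y"
      using C'(1) yD ws ly by (intro Cons.IH) (auto simp: is_reduced_def)
    have "inv ?y \<otimes> s = inv (s \<otimes> ?y)" using s y by (simp add: inv_mult_group)
    then have "len (inv ?y \<otimes> s) = len (inv ?y) + 1"
      using len_inv[of ?y] len_inv[of "s \<otimes> ?y"] s y w l ly by simp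
    then have "\<delta> D C = inv ?y \<otimes> s"
      using dist_up_right[of D C' C s] assms(2) C' Cons.prems(1) s adjacent_sym[of C C' s] DC' by simp
    then show ?case using s y by (simp add: inv_mult_group)
  qed
  moreover obtain ws where "is_reduced W S (\<delta> C D) ws"
    using ex_reduced dist_closed assms by meson
  ultimately show ?thesis using assms by (auto simp: is_reduced_def)
qed

lemma ex_step_right:
  assumes "C \<in> Ch" "D \<in> Ch" "s \<in> S"
  obtains D' where "D' \<in> Ch" "\<delta> D D' = s" "\<delta> C D' = \<delta> C D \<otimes> s"
proof -
  obtain D' where D': "D' \<in> Ch" "\<delta> D D' = s" "\<delta> D' C = s \<otimes> \<delta> D C"
    using ex_step_left[of D C s] assms by blast
  have "\<delta> C D' = inv (s \<otimes> inv (\<delta> C D))"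
    using D' dist_sym[of C D] dist_sym[of D' C] assms by simp
  also have "\<dots> = \<delta> C D \<otimes> s" using assms dist_closed by (simp add: inv_mult_group)
  finally show thesis using that D' by blast
qed

lemma dist_step_right:
  assumes "C \<in> Ch" "D \<in> Ch" "D' \<in> Ch" "s \<in> S" "\<delta> D D' = s"
  shows "\<delta> C D' = \<delta> C D \<otimes> s \<or> \<delta> C D' = \<delta> C D"
proof -
  have "inv (s \<otimes> inv (\<delta> C D)) = \<delta> C D \<otimes> s"
    using assms dist_closed by (simp add: inv_mult_group)
  then show ?thesis
    using dist_step_left[of D C D' s] dist_sym[of D' C] dist_sym[of C D] assms dist_closed by auto
qed

text \<open>Induction principle for residues; with \<open>K = S\<close> it expresses that the
  building is connected. The word for \<open>\<delta> C D\<close> need not be reduced, since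
  \<open>ex_step_left\<close> chooses each next chamber so that exactly one letter is
  removed.\<close>

lemma residue_connected:
  assumes K: "K \<subseteq> S" and D: "D \<in> Ch"
    and step: "\<And>C C' s. C \<in> Ch \<Longrightarrow> C' \<in> Ch \<Longrightarrow> s \<in> K \<Longrightarrow> \<delta> C C' = s \<Longrightarrow> P C \<Longrightarrow> P C'"
    and C: "C \<in> Ch" "P C" "\<delta> C D \<in> generate W K"
  shows "P D"
proof -
  have "P D" if "ws \<in> lists K" "C \<in> Ch" "P C" "\<delta> C D = word_prod W ws" for ws C
    using that
  proof (induction ws arbitrary: C rule: list.induct)
    case Nil
    then show ?case using WD1[of C D] D by simp
  next
    case (Cons s ws)
    have s: "s \<in> K" "s \<in> S" and ws: "ws \<in> lists K" "ws \<in> lists S" using Cons.prems(1) K by auto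
    obtain C' where C': "C' \<in> Ch" "\<delta> C C' = s" "\<delta> C' D = s \<otimes> \<delta> C D"
      using ex_step_left[of C D s] Cons.prems(2) D s by blast
    have "\<delta> C' D = word_prod W ws" using C'(3) Cons.prems(4) s ws by auto
    then show ?case using Cons.IH[OF ws(1) C'(1)] step[of C C' s] Cons.prems C' s by blast
  qed
  then show ?thesis using C generate_words[OF K] by auto
qed

section \<open>Residues as equivalence classes\<close>

lemma in_residue_self: "C \<in> Ch \<Longrightarrow> C \<in> residue C K"
  using generate.one[of W K] by simp

lemma residue_trans:
  assumes "K \<subseteq> S" "C \<in> Ch" "D \<in> Ch" "E \<in> Ch" "\<delta> C D \<in> generate W K" "\<delta> D E \<in> generate W K"
  shows "\<delta> C E \<in> generate W K"
proof (rule residue_connected[OF assms(1) assms(4), of "\<lambda>D. \<delta> C D \<in> generate W K" D])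
  fix D D' s assume *: "D \<in> Ch" "D' \<in> Ch" "s \<in> K" "\<delta> D D' = s" "\<delta> C D \<in> generate W K"
  have "\<delta> C D \<otimes> s \<in> generate W K" using * by (intro generate.eng[OF _ generate.incl])
  moreover have "s \<in> S" using * assms(1) by blast
  ultimately show "\<delta> C D' \<in> generate W K"
    using dist_step_right[OF assms(2) *(1,2) _ *(4)] *(5) by auto
qed (use assms in auto)

lemma residue_eq:
  assumes "K \<subseteq> S" "C \<in> Ch" "D \<in> residue C K"
  shows "residue D K = residue C K"
proof -
  have "\<delta> D C \<in> generate W K"
    using dist_sym[of C D] assms subgroup.m_inv_closed[OF subgroup_generate[OF assms(1)]] by auto
  then show ?thesis using residue_trans[OF assms(1)] assms(2,3) by auto
qed

section \<open>Parallel panels and regularity of thick buildings\<close>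

lemma ex_dist:
  assumes "C \<in> Ch" "w \<in> carrier W"
  shows "\<exists>D\<in>Ch. \<delta> C D = w"
proof -
  have "\<exists>D\<in>Ch. \<delta> D C = word_prod W ws" if "ws \<in> lists S" for ws
    using that
  proof (induction ws rule: list.induct)
    case Nil
    then show ?case using assms by (intro bexI[of _ C]) auto
  next
    case (Cons s ws)
    then obtain D where D: "D \<in> Ch" "\<delta> D C = word_prod W ws" and s: "s \<in> S" by auto
    obtain D' where "D' \<in> Ch" "\<delta> D' C = s \<otimes> \<delta> D C"
      using ex_step_left[OF D(1) assms(1) s] by blast
    then show ?case using D by auto
  qed
  moreover obtain ws where "ws \<in> lists S" "word_prod W ws = inv w"
    using ex_word assms by blast
  ultimately obtain D where "D \<in> Ch" "\<delta> D C = inv w" by metis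
  then show ?thesis using dist_sym[of D C] assms by auto
qed

text \<open>A chamber \<open>C'\<close> of the \<open>s\<close>-panel of \<open>C\<close> is sent to
  a chamber \<open>X'\<close> of the \<open>t\<close>-panel of \<open>X\<close> with
  \<open>\<delta> C' X' = u\<close>. Two chambers with the same image would be
  \<open>s\<close>-adjacent, and passing from one to the other would lengthen \<open>u\<close> to
  \<open>s u\<close>.\<close>

lemma card_parallel_le:
  assumes fin: "finite Ch" and C: "C \<in> Ch" and X: "X \<in> Ch" and s: "s \<in> S" and t: "t \<in> S"
    and u: "u \<in> carrier W" and eq: "s \<otimes> u = u \<otimes> t"
    and up: "len (s \<otimes> u) = len u + 1" and d: "\<delta> C X = s \<otimes> u"
  shows "card (sphere C s) \<le> card (sphere X t)"
proof -
  let ?P = "insert C (sphere C s)" and ?Q = "insert X (sphere X t)"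
  have "\<exists>X'\<in>?Q. \<delta> C' X' = u" if C': "C' \<in> ?P" for C'
  proof -
    have "\<delta> C' X = s \<otimes> u \<or> \<delta> C' X = u"
      using C' d dist_step_left[of C X C' s] C X s u by auto
    then show ?thesis
    proof
      assume *: "\<delta> C' X = s \<otimes> u"
      have "C' \<in> Ch" using C' C by auto
      then obtain X' where "X' \<in> Ch" "\<delta> X X' = t" "\<delta> C' X' = \<delta> C' X \<otimes> t"
        using ex_step_right[OF _ X t] by blast
      then show ?thesis using * eq t u by auto
    qed auto
  qed
  then have "\<forall>C'\<in>?P. \<exists>X'. X' \<in> ?Q \<and> \<delta> C' X' = u" by blast
  from bchoice[OF this] obtain f where f0: "\<forall>C'\<in>?P. f C' \<in> ?Q \<and> \<delta> C' (f C') = u" ..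
  note f = bspec[OF f0]
  have "inj_on f ?P"
  proof (rule inj_onI, rule ccontr)
    fix A B assume AB: "A \<in> ?P" "B \<in> ?P" "f A = f B" "A \<noteq> B"
    have Ch: "A \<in> Ch" "B \<in> Ch" "f A \<in> Ch" using AB f[OF AB(1)] C X by auto
    have "\<delta> A B = s"
    proof (cases "A = C \<or> B = C")
      case True
      then show ?thesis using AB adjacent_sym[OF C Ch(1) s] by auto
    next
      case False
      then show ?thesis using AB panel_adjacent[OF C Ch(1,2) s] by auto
    qed
    then have "\<delta> B (f A) = s \<otimes> u"
      using dist_up_left[OF Ch(1,3,2) s] f[OF AB(1)] up by simp
    then show False using f[OF AB(2)] AB(3) gen_mult_ne[OF s u] by simp
  qed
  then have "card ?P \<le> card ?Q" using f fin by (intro card_inj_on_le[of f]) auto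
  moreover have "C \<notin> sphere C s" "X \<notin> sphere X t"
    using C X gen_not_one[OF s] gen_not_one[OF t] by auto
  ultimately show ?thesis using fin by simp
qed

lemma card_parallel_eq:
  assumes fin: "finite Ch" and C: "C \<in> Ch" and X: "X \<in> Ch" and s: "s \<in> S" and t: "t \<in> S"
    and u: "u \<in> carrier W" and eq: "s \<otimes> u = u \<otimes> t"
    and up: "len (s \<otimes> u) = len u + 1" and d: "\<delta> C X = s \<otimes> u"
  shows "card (sphere C s) = card (sphere X t)"
proof (rule antisym)
  have "inv (u \<otimes> t) = t \<otimes> inv u" "inv (s \<otimes> u) = inv u \<otimes> s"
    using s t u by (simp_all add: inv_mult_group)
  then have eq': "t \<otimes> inv u = inv (s \<otimes> u)" "inv u \<otimes> s = inv (s \<otimes> u)"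
    using eq by simp_all
  have "len (t \<otimes> inv u) = len (inv u) + 1"
    unfolding eq' using len_inv[of u] len_inv[of "s \<otimes> u"] s u up by simp
  moreover have "\<delta> X C = t \<otimes> inv u"
    unfolding eq' using dist_sym[OF C X] d by simp
  ultimately show "card (sphere X t) \<le> card (sphere C s)"
    using eq' u by (intro card_parallel_le[OF fin X C t s, of "inv u"]) auto
qed (rule card_parallel_le[OF assms])

text \<open>Adjacent chambers \<open>C\<close>, \<open>D\<close> have a common opposite \<open>X\<close>, found from a third chamber of their
  panel; the \<open>s\<close>-panels of \<open>C\<close> and of \<open>D\<close> are both parallel to the same panel of \<open>X\<close>.\<close>

lemma thick_regular:
  assumes fin: "finite Ch" and finW: "finite (carrier W)" and thick: "thick S Ch \<delta>"
    and s: "s \<in> S" and C: "C \<in> Ch" and D: "D \<in> Ch"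
  shows "card (sphere C s) = card (sphere D s)"
proof -
  define w where "w = longest_elt W S S"
  have w: "w \<in> carrier W"
    unfolding w_def using longest_elt_props(1)[OF subset_refl] finW gens_generate by simp
  have up: "len w = len (s \<otimes> w) + 1" if "s \<in> S" for s
    unfolding w_def by (rule longest_conj_gen(2)[OF finW that])
  let ?s' = "inv w \<otimes> s \<otimes> w"
  have s': "?s' \<in> S" unfolding w_def by (rule longest_conj_gen(1)[OF finW s])
  have opp: "card (sphere A s) = card (sphere X ?s')"
    if "A \<in> Ch" "X \<in> Ch" "\<delta> A X = w" for A X
  proof (rule card_parallel_eq[OF fin that(1,2) s s', of "s \<otimes> w"])
    show "s \<otimes> (s \<otimes> w) = s \<otimes> w \<otimes> ?s'"
      using s w by (simp add: m_assoc) (simp flip: m_assoc)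
    then show "len (s \<otimes> (s \<otimes> w)) = len (s \<otimes> w) + 1" using s w up by simp
    show "\<delta> A X = s \<otimes> (s \<otimes> w)" using s w that by simp
  qed (use s w in auto)
  have step: "card (sphere A s) = card (sphere B s)"
    if A: "A \<in> Ch" and B: "B \<in> Ch" and t: "t \<in> S" and AB: "\<delta> A B = t" for A B t
  proof -
    obtain E where E: "E \<in> Ch" "\<delta> A E = t" "E \<noteq> B"
      using thick A t unfolding thick_def by metis
    have EA: "\<delta> E A = t" "\<delta> E B = t"
      using E adjacent_sym[of A E t] panel_adjacent[of A E B t] A B t AB by auto
    obtain X where X: "X \<in> Ch" "\<delta> E X = t \<otimes> w"
      using ex_dist[OF E(1), of "t \<otimes> w"] t w by auto
    have "\<delta> A X = w" "\<delta> B X = w"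
      using dist_up_left[of E X A t] dist_up_left[of E X B t] E X A B EA t w up[OF t] by auto
    then show ?thesis using opp[OF A X(1)] opp[OF B X(1)] by simp
  qed
  show ?thesis
    by (rule residue_connected[OF subset_refl D, of "\<lambda>A. card (sphere C s) = card (sphere A s)" C])
      (use step C D gens_generate dist_closed in auto)
qed

end

text \<open>Isolates what the counting needs, so that it applies twice: to \<Delta>, where
  regularity comes from \<open>thick_regular\<close>, and to the fixed building, where it comes from
  \<open>fixed_regular\<close>.\<close>

locale regular_building = building +
  assumes finite_chambers: "finite Ch"
    and regular: "\<And>C D s. C \<in> Ch \<Longrightarrow> D \<in> Ch \<Longrightarrow> s \<in> S \<Longrightarrow>
      card {E \<in> Ch. \<delta> C E = s} = card {E \<in> Ch. \<delta> D E = s}"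
begin

abbreviation q :: "'a \<Rightarrow> real" where
  "q \<equiv> param Ch \<delta>"

abbreviation wt :: "'a \<Rightarrow> real" where
  "wt \<equiv> weight W S q"

section \<open>Sizes of spheres and residues\<close>

lemma card_sphere_gen:
  assumes "C \<in> Ch" "s \<in> S"
  shows "real (card (sphere C s)) = q s"
  using regular[of C "SOME C. C \<in> Ch" s] assms someI[of "\<lambda>C. C \<in> Ch" C]
  unfolding param_def by simp

text \<open>A sphere is cut up by the first step of a gallery. Two chambers of one
  \<open>s\<close>-panel cannot both have distance \<open>y\<close> to \<open>E\<close>, since
  passing from one to the other lengthens \<open>y\<close> to \<open>s y\<close>.\<close>

lemma card_sphere_reduced:
  assumes "C \<in> Ch" "is_reduced W S w ws"
  shows "real (card (sphere C w)) = prod_list (map q ws)"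
  using assms
proof (induction ws arbitrary: w C rule: list.induct)
  case Nil
  then have "sphere C w = {C}" using WD1[of C] by (auto simp: is_reduced_def)
  then show ?case by simp
next
  case (Cons s ws)
  have s: "s \<in> S" and ws: "ws \<in> lists S" and w: "w = s \<otimes> word_prod W ws"
    and l: "len w = Suc (length ws)" and C: "C \<in> Ch"
    using Cons.prems by (auto simp: is_reduced_def)
  let ?y = "word_prod W ws"
  have y: "?y \<in> carrier W" using ws by blast
  have ly: "len ?y = length ws" using len_le[OF ws] len_gen_mult[OF s y] w l by auto
  have up: "len (s \<otimes> ?y) = len ?y + 1" using ly l w by simp
  have IH: "real (card (sphere D ?y)) = prod_list (map q ws)" if "D \<in> Ch" for D
    using Cons.IH[OF that, of ?y] ws ly by (auto simp: is_reduced_def)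
  have "sphere C w = (\<Union>D\<in>sphere C s. sphere D ?y)"
  proof (intro equalityI subsetI)
    fix E assume E: "E \<in> sphere C w"
    obtain D where "D \<in> Ch" "\<delta> C D = s" "\<delta> D E = s \<otimes> \<delta> C E"
      using ex_step_left[of C E s] C E s by blast
    then show "E \<in> (\<Union>D\<in>sphere C s. sphere D ?y)" using E w s y by auto
  next
    fix E assume "E \<in> (\<Union>D\<in>sphere C s. sphere D ?y)"
    then obtain D where D: "D \<in> Ch" "\<delta> C D = s" "E \<in> Ch" "\<delta> D E = ?y" by auto
    then show "E \<in> sphere C w"
      using dist_up_left[of D E C s] adjacent_sym[of C D s] C s up w by simp
  qed
  moreover have "disjoint_family_on (\<lambda>D. sphere D ?y) (sphere C s)"
    unfolding disjoint_family_on_def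
  proof (intro ballI impI)
    fix D D' assume D: "D \<in> sphere C s" "D' \<in> sphere C s" "D \<noteq> D'"
    then have DD: "\<delta> D D' = s" using panel_adjacent[of C D D' s] C s by auto
    show "sphere D ?y \<inter> sphere D' ?y = {}"
    proof (rule ccontr)
      assume "sphere D ?y \<inter> sphere D' ?y \<noteq> {}"
      then obtain E where "E \<in> Ch" "\<delta> D E = ?y" "\<delta> D' E = ?y" by auto
      then show False
        using dist_up_left[of D E D' s] D DD s up gen_mult_ne[OF s y] by auto
    qed
  qed
  ultimately have "card (sphere C w) = (\<Sum>D\<in>sphere C s. card (sphere D ?y))"
    using finite_chambers by (simp add: card_UN_disjoint' )
  then have "real (card (sphere C w)) = (\<Sum>D\<in>sphere C s. prod_list (map q ws))"
    using IH by simp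
  then show ?case using card_sphere_gen[OF C s] by simp
qed

text \<open>The size of a sphere is the product along any reduced word, so the choice made by
  \<open>SOME\<close> in \<open>weight\<close> has no influence.\<close>

lemma weight_reduced:
  assumes "is_reduced W S w ws"
  shows "wt w = prod_list (map q ws)"
proof -
  obtain C where "C \<in> Ch" using chambers_nonempty by auto
  then show ?thesis
    using card_sphere_reduced[of C w] assms someI[of "is_reduced W S w" ws]
    unfolding weight_def by (metis (no_types))
qed

lemma card_sphere:
  assumes "C \<in> Ch" "w \<in> carrier W"
  shows "real (card (sphere C w)) = wt w"
  using ex_reduced[OF assms(2)] card_sphere_reduced[OF assms(1)] weight_reduced by metis

lemma weight_pos:
  assumes "w \<in> carrier W"
  shows "wt w > 0"
proof -
  obtain C where C: "C \<in> Ch" using chambers_nonempty by auto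
  then have "sphere C w \<noteq> {}" using ex_dist[OF C assms] by auto
  then show ?thesis using card_sphere[OF C assms] finite_chambers by (metis (no_types, lifting) card_gt_0_iff finite_Collect_conjI mem_Collect_eq finite_subset subsetI of_nat_0_less_iff)
qed

lemma weight_sandwich:
  assumes s: "s \<in> S" and t: "t \<in> S" and w: "w \<in> carrier W" and l: "len (s \<otimes> w \<otimes> t) = len w + 2"
  shows "wt (s \<otimes> w \<otimes> t) = q s * wt w * q t"
proof -
  obtain ws where ws: "is_reduced W S w ws" using ex_reduced w by metis
  then have "ws \<in> lists S" "word_prod W ws = w" "length ws = len w"
    by (auto simp: is_reduced_def)
  then have "is_reduced W S (s \<otimes> w \<otimes> t) (s # ws @ [t])"
    using s t w l by (auto simp: is_reduced_def word_prod_append m_assoc)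
  then show ?thesis using weight_reduced[OF ws] weight_reduced by fastforce
qed

lemma card_residue:
  assumes "K \<subseteq> S" "finite (carrier W)" "C \<in> Ch"
  shows "real (card (residue C K)) = poincare W S q (generate W K)"
proof -
  have fin: "finite (generate W K)"
    using assms generate_closed[OF assms(1)] by (meson finite_subset subsetI)
  have "residue C K = (\<Union>w\<in>generate W K. sphere C w)" by auto
  also have "card \<dots> = (\<Sum>w\<in>generate W K. card (sphere C w))"
    using fin finite_chambers by (intro card_UN_disjoint) auto
  finally show ?thesis
    unfolding poincare_def using card_sphere[OF assms(3)] generate_closed[OF assms(1)] by simp
qed

lemma card_chambers:
  assumes "finite (carrier W)"
  shows "real (card Ch) = poincare W S q (carrier W)"
proof -
  obtain C where C: "C \<in> Ch" using chambers_nonempty by auto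
  then have "residue C S = Ch" using dist_closed gens_generate by auto
  then show ?thesis using card_residue[OF subset_refl assms C] gens_generate by simp
qed

end

section \<open>Displacements of a uniclass automorphism\<close>

locale uniclass_automorphism = regular_building +
  fixes \<theta> :: "'c \<Rightarrow> 'c" and \<sigma> :: "'a \<Rightarrow> 'a"
  assumes finite_group: "finite (carrier W)"
    and thick: "thick S Ch \<delta>"
    and automorphism: "building_automorphism W S Ch \<delta> \<theta> \<sigma>"
    and uniclass: "uniclass W Ch \<delta> \<theta> \<sigma>"
begin

abbreviation dp :: "'c \<Rightarrow> 'a" where
  "dp C \<equiv> \<delta> C (\<theta> C)"

section \<open>Elementary properties of \<theta> and \<sigma>\<close>

lemma \<sigma>_hom: "\<sigma> \<in> hom W W"
  and \<sigma>_bij: "bij_betw \<sigma> (carrier W) (carrier W)"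
  and \<sigma>_gens: "\<sigma> ` S = S"
  and \<theta>_bij: "bij_betw \<theta> Ch Ch"
  using automorphism by (auto simp: building_automorphism_def iso_def)

lemma \<sigma>_closed [simp, intro]: "w \<in> carrier W \<Longrightarrow> \<sigma> w \<in> carrier W"
  using \<sigma>_bij bij_betwE by blast

lemma \<sigma>_mult [simp]: "v \<in> carrier W \<Longrightarrow> w \<in> carrier W \<Longrightarrow> \<sigma> (v \<otimes> w) = \<sigma> v \<otimes> \<sigma> w"
  using \<sigma>_hom by (simp add: hom_mult)

lemma \<sigma>_one [simp]: "\<sigma> \<one> = \<one>"
  using hom_one[OF \<sigma>_hom is_group is_group] .

lemma \<sigma>_inj: "v \<in> carrier W \<Longrightarrow> w \<in> carrier W \<Longrightarrow> \<sigma> v = \<sigma> w \<longleftrightarrow> v = w"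
  using \<sigma>_bij by (meson bij_betw_def inj_on_eq_iff)

lemma \<sigma>_gen [simp, intro]: "s \<in> S \<Longrightarrow> \<sigma> s \<in> S"
  using \<sigma>_gens by blast

lemma \<theta>_closed [simp, intro]: "C \<in> Ch \<Longrightarrow> \<theta> C \<in> Ch"
  using \<theta>_bij bij_betwE by blast

lemma \<theta>_inj: "C \<in> Ch \<Longrightarrow> D \<in> Ch \<Longrightarrow> \<theta> C = \<theta> D \<longleftrightarrow> C = D"
  using \<theta>_bij by (meson bij_betw_def inj_on_eq_iff)

lemma \<theta>_adjacent: "C \<in> Ch \<Longrightarrow> D \<in> Ch \<Longrightarrow> s \<in> S \<Longrightarrow> \<delta> C D = s \<longleftrightarrow> \<delta> (\<theta> C) (\<theta> D) = \<sigma> s"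
  using automorphism by (auto simp: building_automorphism_def)

lemma dp_closed [simp, intro]: "C \<in> Ch \<Longrightarrow> dp C \<in> carrier W"
  by (simp add: dist_closed)

lemma \<sigma>_word: "ws \<in> lists S \<Longrightarrow> \<sigma> (word_prod W ws) = word_prod W (map \<sigma> ws)"
  by (induction ws) auto

lemma len_\<sigma>:
  assumes "w \<in> carrier W"
  shows "len (\<sigma> w) = len w"
proof (rule antisym)
  obtain ws where "is_reduced W S w ws" using ex_reduced assms by metis
  then have ws: "ws \<in> lists S" "word_prod W ws = w" "length ws = len w" by (auto simp: is_reduced_def)
  moreover from this have "map \<sigma> ws \<in> lists S" by (auto simp: in_lists_conv_set)
  ultimately show "len (\<sigma> w) \<le> len w" using \<sigma>_word[of ws] len_le[of "map \<sigma> ws"] by simp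
next
  obtain ws where "is_reduced W S (\<sigma> w) ws" using ex_reduced assms by (metis \<sigma>_closed)
  then have ws: "ws \<in> lists S" "word_prod W ws = \<sigma> w" "length ws = len (\<sigma> w)"
    by (auto simp: is_reduced_def)
  have "ws \<in> lists (\<sigma> ` S)" using ws \<sigma>_gens by simp
  then obtain vs where vs: "vs \<in> lists S" "ws = map \<sigma> vs" by (auto simp: lists_image)
  then have "word_prod W vs = w"
    using ws \<sigma>_word[of vs] \<sigma>_inj[of "word_prod W vs" w] assms by auto
  then show "len w \<le> len (\<sigma> w)" using len_le[of vs] vs ws by simp
qed

text \<open>The definition \<open>building_automorphism\<close> prescribes only distances that are
  generators. Since \<sigma> preserves length, each step along a reduced word stays upward after
  applying \<theta>, and the distance builds up letter by letter.\<close>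

lemma dist_\<theta>:
  assumes "C \<in> Ch" "D \<in> Ch"
  shows "\<delta> (\<theta> C) (\<theta> D) = \<sigma> (\<delta> C D)"
proof -
  have "\<delta> (\<theta> C) (\<theta> D) = \<sigma> (\<delta> C D)" if "C \<in> Ch" "is_reduced W S (\<delta> C D) ws" for ws C
    using that
  proof (induction ws arbitrary: C rule: list.induct)
    case Nil
    then show ?case using assms WD1[of C D] by (simp add: is_reduced_def)
  next
    case (Cons s ws)
    have s: "s \<in> S" and ws: "ws \<in> lists S" and w: "\<delta> C D = s \<otimes> word_prod W ws"
      and l: "len (\<delta> C D) = Suc (length ws)"
      using Cons.prems(2) by (auto simp: is_reduced_def)
    let ?y = "word_prod W ws"
    have y: "?y \<in> carrier W" using ws by blast
    obtain C' where C': "C' \<in> Ch" "\<delta> C C' = s" "\<delta> C' D = s \<otimes> \<delta> C D"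
      using ex_step_left[of C D s] Cons.prems(1) assms(2) s by blast
    have yD: "\<delta> C' D = ?y" using C' w s y by simp
    have ly: "len ?y = length ws"
      using len_le[OF ws] len_gen_mult[OF s y] w l by auto
    have IH: "\<delta> (\<theta> C') (\<theta> D) = \<sigma> ?y"
      using Cons.IH[OF C'(1)] yD ws ly by (auto simp: is_reduced_def)
    have "len (\<sigma> s \<otimes> \<sigma> ?y) = len (\<sigma> ?y) + 1"
      using len_\<sigma>[of "s \<otimes> ?y"] len_\<sigma>[OF y] s y w l ly by simp
    moreover have "\<delta> (\<theta> C') (\<theta> C) = \<sigma> s"
      using \<theta>_adjacent[of C' C s] adjacent_sym[of C C' s] Cons.prems(1) C' s by simp
    ultimately have "\<delta> (\<theta> C) (\<theta> D) = \<sigma> s \<otimes> \<sigma> ?y"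
      using dist_up_left[of "\<theta> C'" "\<theta> D" "\<theta> C" "\<sigma> s"] Cons.prems(1) C'(1) assms(2) s IH by simp
    then show ?case using w s y by simp
  qed
  moreover obtain ws where "is_reduced W S (\<delta> C D) ws"
    using ex_reduced dist_closed assms by meson
  ultimately show ?thesis using assms by (auto simp: is_reduced_def)
qed

lemma q_\<sigma>:
  assumes "s \<in> S"
  shows "q (\<sigma> s) = q s"
proof -
  obtain C where C: "C \<in> Ch" using chambers_nonempty by auto
  have "\<theta> ` sphere C s = sphere (\<theta> C) (\<sigma> s)"
  proof (intro equalityI subsetI)
    fix E assume "E \<in> \<theta> ` sphere C s"
    then show "E \<in> sphere (\<theta> C) (\<sigma> s)" using \<theta>_adjacent[OF C _ assms] by auto
  next
    fix E assume E: "E \<in> sphere (\<theta> C) (\<sigma> s)"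
    then obtain D where "D \<in> Ch" "E = \<theta> D" using \<theta>_bij by (auto simp: bij_betw_def)
    then show "E \<in> \<theta> ` sphere C s" using \<theta>_adjacent[OF C _ assms] E by auto
  qed
  moreover have "inj_on \<theta> (sphere C s)" using \<theta>_inj by (auto intro!: inj_onI)
  then have "card (\<theta> ` sphere C s) = card (sphere C s)" by (rule card_image)
  ultimately have "card (sphere (\<theta> C) (\<sigma> s)) = card (sphere C s)" by simp
  then show ?thesis
    using card_sphere_gen[OF C assms] card_sphere_gen[OF \<theta>_closed[OF C] \<sigma>_gen[OF assms]] by simp
qed

section \<open>Displacements on a panel\<close>

lemma even_len_dp:
  assumes "C \<in> Ch" "D \<in> Ch"
  shows "even (len (dp C)) = even (len (dp D))"
proof -
  obtain w where w: "w \<in> carrier W" "disp Ch \<delta> \<theta> \<subseteq> twisted_class W \<sigma> w"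
    using uniclass by (auto simp: uniclass_def)
  have "even (len (dp C)) = even (len w)" if "C \<in> Ch" for C
  proof -
    have "dp C \<in> disp Ch \<delta> \<theta>" using that by (auto simp: disp_def)
    then have "dp C \<in> twisted_class W \<sigma> w" using w(2) by (rule subsetD[rotated])
    then obtain v where v: "v \<in> carrier W" "dp C = inv v \<otimes> w \<otimes> \<sigma> v"
      by (auto simp: twisted_class_def)
    \<comment> \<open>This is where \<open>uniclass\<close> enters: inversion and \<sigma> preserve
      length, so \<open>v\<close> is counted twice.\<close>
    have "even (len (dp C)) = even (len v + len w + len v)"
      unfolding v(2) using v(1) w(1) len_\<sigma>[OF v(1)] len_inv[OF v(1)] by (simp add: even_len_mult)
    then show ?thesis by presburger
  qed
  then show ?thesis using assms by simp
qed

text \<open>Moving the two arguments of \<delta> one after the other leaves four candidates; parity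
  excludes the two that change the length by one.\<close>

lemma dp_adjacent:
  assumes "C \<in> Ch" "D \<in> Ch" "s \<in> S" "\<delta> C D = s"
  shows "dp D = dp C \<or> dp D = s \<otimes> dp C \<otimes> \<sigma> s"
proof -
  have w: "dp C \<in> carrier W" using assms by blast
  have *: "\<delta> (\<theta> C) (\<theta> D) = \<sigma> s" using \<theta>_adjacent assms by blast
  have "\<delta> D (\<theta> C) = s \<otimes> dp C \<or> \<delta> D (\<theta> C) = dp C"
    using dist_step_left[of C "\<theta> C" D s] assms by blast
  moreover have "dp D = \<delta> D (\<theta> C) \<otimes> \<sigma> s \<or> dp D = \<delta> D (\<theta> C)"
    using dist_step_right[of D "\<theta> C" "\<theta> D" "\<sigma> s"] assms * by blast
  moreover have "dp D \<noteq> s \<otimes> dp C" "dp D \<noteq> dp C \<otimes> \<sigma> s"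
    using even_len_dp[of C D] even_len_mult[of s "dp C"] even_len_mult[of "dp C" "\<sigma> s"] assms w
    by auto
  ultimately show ?thesis by metis
qed

lemma dp_adjacent_up:
  assumes "C \<in> Ch" "D \<in> Ch" "s \<in> S" "\<delta> C D = s"
    and l: "len (s \<otimes> dp C \<otimes> \<sigma> s) = len (dp C) + 2"
  shows "dp D = s \<otimes> dp C \<otimes> \<sigma> s"
proof -
  have w: "dp C \<in> carrier W" "s \<otimes> dp C \<in> carrier W" using assms by auto
  have *: "\<delta> (\<theta> C) (\<theta> D) = \<sigma> s" using \<theta>_adjacent assms by blast
  have l': "len (s \<otimes> dp C) = len (dp C) + 1" "len (s \<otimes> dp C \<otimes> \<sigma> s) = len (s \<otimes> dp C) + 1"
    using len_gen_mult[OF assms(3) w(1)] len_mult_gen[OF \<sigma>_gen[OF assms(3)] w(2)] l by arith+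
  have "\<delta> D (\<theta> C) = s \<otimes> dp C"
    using dist_up_left[of C "\<theta> C" D s] assms l' by simp
  then show ?thesis
    using dist_up_right[of D "\<theta> C" "\<theta> D" "\<sigma> s"] assms l' * by simp
qed

text \<open>The chamber nearest to \<open>\<theta> C\<close> in the \<open>s\<close>-panel of
  \<open>C\<close>, or to \<open>C\<close> in the \<open>\<sigma> s\<close>-panel of
  \<open>\<theta> C\<close>, is avoided by one of two neighbours supplied by thickness. If only one
  side were a descent, the displacement of that neighbour would differ in length by one, against
  parity.\<close>

lemma dp_descents:
  assumes C: "C \<in> Ch" and s: "s \<in> S"
  shows "len (s \<otimes> dp C) = len (dp C) + 1 \<longleftrightarrow> len (dp C \<otimes> \<sigma> s) = len (dp C) + 1"
proof (rule ccontr)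
  have w: "dp C \<in> carrier W" and t: "\<sigma> s \<in> S" using C s by auto
  obtain D1 D2 where D12: "D1 \<in> Ch" "D2 \<in> Ch" "D1 \<noteq> D2" "\<delta> C D1 = s" "\<delta> C D2 = s"
    using thick C s unfolding thick_def by metis
  assume "\<not> ?thesis"
  then consider "len (dp C) = len (s \<otimes> dp C) + 1" "len (dp C \<otimes> \<sigma> s) = len (dp C) + 1"
    | "len (s \<otimes> dp C) = len (dp C) + 1" "len (dp C) = len (dp C \<otimes> \<sigma> s) + 1"
    using len_gen_mult[OF s w] len_mult_gen[OF t w] by blast
  then show False
  proof cases
    case 1
    obtain X where X: "X \<in> Ch" "\<delta> C X = s" "\<delta> X (\<theta> C) = s \<otimes> dp C"
      using ex_step_left[OF C \<theta>_closed[OF C] s] by blast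
    obtain D where D: "D \<in> Ch" "\<delta> C D = s" "D \<noteq> X" using D12 by metis
    have "\<delta> X D = s" using panel_adjacent[of C X D s] C X D s by auto
    then have "\<delta> D (\<theta> C) = dp C"
      using dist_up_left[of X "\<theta> C" D s] X D C s w 1 by simp
    moreover have "\<delta> (\<theta> C) (\<theta> D) = \<sigma> s" using \<theta>_adjacent C D s by blast
    ultimately have "dp D = dp C \<otimes> \<sigma> s"
      using dist_up_right[of D "\<theta> C" "\<theta> D" "\<sigma> s"] C D t 1 by simp
    then show False using even_len_dp[OF C D(1)] 1(2) by simp
  next
    case 2
    obtain Y where Y: "Y \<in> Ch" "\<delta> (\<theta> C) Y = \<sigma> s" "\<delta> C Y = dp C \<otimes> \<sigma> s"
      using ex_step_right[OF C \<theta>_closed[OF C] t] by blast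
    obtain D where D: "D \<in> Ch" "\<delta> C D = s" "\<theta> D \<noteq> Y" using D12 \<theta>_inj by metis
    have *: "\<delta> (\<theta> C) (\<theta> D) = \<sigma> s" using \<theta>_adjacent C D s by blast
    then have "\<delta> Y (\<theta> D) = \<sigma> s" using panel_adjacent[of "\<theta> C" Y "\<theta> D" "\<sigma> s"] C Y D t by auto
    then have "\<delta> C (\<theta> D) = dp C"
      using dist_up_right[of C Y "\<theta> D" "\<sigma> s"] Y D C t w 2 by simp
    then have "dp D = s \<otimes> dp C"
      using dist_up_left[of C "\<theta> D" D s] C D s 2 by simp
    then show False using even_len_dp[OF C D(1)] 2(1) by simp
  qed
qed

lemma dp_trichotomy:
  assumes C: "C \<in> Ch" and s: "s \<in> S"
  shows "len (s \<otimes> dp C \<otimes> \<sigma> s) = len (dp C) + 2 \<or> s \<otimes> dp C \<otimes> \<sigma> s = dp C \<or>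
    len (dp C) = len (s \<otimes> dp C \<otimes> \<sigma> s) + 2"
proof -
  have w: "dp C \<in> carrier W" and t: "\<sigma> s \<in> S" using C s by auto
  show ?thesis
    using folding[OF s t w] folding_down[OF s t w] dp_descents[OF C s]
      len_gen_mult[OF s w] len_mult_gen[OF t w] by blast
qed

text \<open>The projection \<open>X\<close> of \<open>\<theta> C\<close> to the panel is the chamber
  sought. Seen from \<open>X\<close> the displacement goes up, so every other chamber of the panel
  has displacement \<open>dp C\<close> again.\<close>

lemma dp_adjacent_down:
  assumes C: "C \<in> Ch" and s: "s \<in> S" and l: "len (dp C) = len (s \<otimes> dp C \<otimes> \<sigma> s) + 2"
  shows "\<exists>!D. D \<in> Ch \<and> \<delta> C D = s \<and> dp D = s \<otimes> dp C \<otimes> \<sigma> s"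
proof -
  have w: "dp C \<in> carrier W" and t: "\<sigma> s \<in> S" using C s by auto
  obtain X where X: "X \<in> Ch" "\<delta> C X = s" "\<delta> X (\<theta> C) = s \<otimes> dp C"
    using ex_step_left[OF C \<theta>_closed[OF C] s] by blast
  have "\<delta> (\<theta> C) (\<theta> X) = \<sigma> s" using \<theta>_adjacent C X s by blast
  then have "dp X = s \<otimes> dp C \<otimes> \<sigma> s \<or> dp X = s \<otimes> dp C"
    using dist_step_right[of X "\<theta> C" "\<theta> X" "\<sigma> s"] C X t by auto
  then have dX: "dp X = s \<otimes> dp C \<otimes> \<sigma> s"
    using dp_adjacent[OF C X(1) s X(2)] gen_mult_ne[OF s w] by metis
  have rev_step: "s \<otimes> dp X \<otimes> \<sigma> s = dp C" unfolding dX using s t w by (simp add: m_assoc)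
  have "D = X" if D: "D \<in> Ch" "\<delta> C D = s" "dp D = s \<otimes> dp C \<otimes> \<sigma> s" for D
  proof (rule ccontr)
    assume "D \<noteq> X"
    then have "\<delta> X D = s" using panel_adjacent[of C X D s] C X D s by auto
    then have "dp D = dp C"
      using dp_adjacent_up[OF X(1) D(1) s] unfolding rev_step using l dX by simp
    then show False using D(3) l by simp
  qed
  then show ?thesis using X dX by blast
qed

section \<open>Counting chambers by displacement inside a residue\<close>

definition displaced_in :: "'c set \<Rightarrow> 'a \<Rightarrow> 'c set" where
  "displaced_in R w = {C \<in> R. dp C = w}"

text \<open>By \<open>dp_adjacent_down\<close> each chamber with the longer displacement has exactly
  one \<open>s\<close>-neighbour with the shorter one, and by \<open>dp_adjacent_up\<close> all
  \<open>q s\<close> neighbours of the latter have the longer one.\<close>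

lemma card_displaced_up:
  assumes R: "R \<subseteq> Ch" and closed: "\<And>C D. C \<in> R \<Longrightarrow> D \<in> Ch \<Longrightarrow> \<delta> C D = s \<Longrightarrow> D \<in> R"
    and s: "s \<in> S" and w: "w \<in> carrier W" and l: "len (s \<otimes> w \<otimes> \<sigma> s) = len w + 2"
  shows "real (card (displaced_in R (s \<otimes> w \<otimes> \<sigma> s))) = real (card (displaced_in R w)) * q s"
proof -
  let ?w' = "s \<otimes> w \<otimes> \<sigma> s"
  have t: "\<sigma> s \<in> S" using s by blast
  have rev_step: "s \<otimes> ?w' \<otimes> \<sigma> s = w" using s t w by (simp add: m_assoc)
  have "displaced_in R ?w' = (\<Union>C\<in>displaced_in R w. sphere C s)"
  proof (intro equalityI subsetI)
    fix D assume D: "D \<in> displaced_in R ?w'"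
    then have DC: "D \<in> Ch" "dp D = ?w'" using R by (auto simp: displaced_in_def)
    then obtain C where C: "C \<in> Ch" "\<delta> D C = s" "dp C = w"
      using dp_adjacent_down[OF DC(1) s] l unfolding DC(2) rev_step by blast
    then have "C \<in> displaced_in R w" using closed[of D C] D by (auto simp: displaced_in_def)
    then show "D \<in> (\<Union>C\<in>displaced_in R w. sphere C s)"
      using adjacent_sym[of D C s] C DC s by auto
  next
    fix D assume "D \<in> (\<Union>C\<in>displaced_in R w. sphere C s)"
    then obtain C where "C \<in> R" "dp C = w" "D \<in> Ch" "\<delta> C D = s" by (auto simp: displaced_in_def)
    then show "D \<in> displaced_in R ?w'"
      using closed[of C D] dp_adjacent_up[of C D s] R s l by (auto simp: displaced_in_def)
  qed
  moreover have "disjoint_family_on (\<lambda>C. sphere C s) (displaced_in R w)"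
    unfolding disjoint_family_on_def
  proof (intro ballI impI)
    fix C C' assume CC: "C \<in> displaced_in R w" "C' \<in> displaced_in R w" "C \<noteq> C'"
    then have Ch: "C \<in> Ch" "C' \<in> Ch" "dp C = w" "dp C' = w" using R by (auto simp: displaced_in_def)
    show "sphere C s \<inter> sphere C' s = {}"
    proof (rule ccontr)
      assume "sphere C s \<inter> sphere C' s \<noteq> {}"
      then obtain D where D: "D \<in> Ch" "\<delta> C D = s" "\<delta> C' D = s" by auto
      have dD: "dp D = ?w'" using dp_adjacent_up[OF Ch(1) D(1) s D(2)] Ch l by simp
      have "\<exists>!E. E \<in> Ch \<and> \<delta> D E = s \<and> dp E = w"
        using dp_adjacent_down[OF D(1) s] unfolding dD rev_step using l by simp
      then show False using adjacent_sym[OF _ D(1) s] Ch D CC(3) by metis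
    qed
  qed
  moreover have "finite (displaced_in R w)"
    using finite_chambers R by (auto simp: displaced_in_def intro: finite_subset)
  ultimately have "card (displaced_in R ?w') = (\<Sum>C\<in>displaced_in R w. card (sphere C s))"
    using finite_chambers by (simp add: card_UN_disjoint')
  moreover have "(\<Sum>C\<in>displaced_in R w. real (card (sphere C s))) = (\<Sum>C\<in>displaced_in R w. q s)"
    using card_sphere_gen s R by (intro sum.cong) (auto simp: displaced_in_def)
  ultimately show ?thesis by simp
qed

lemma displaced_ratio_step:
  assumes R: "R \<subseteq> Ch" and closed: "\<And>C D. C \<in> R \<Longrightarrow> D \<in> Ch \<Longrightarrow> \<delta> C D = s \<Longrightarrow> D \<in> R"
    and s: "s \<in> S" and C: "C \<in> R" "dp C = w"
  shows "real (card (displaced_in R (s \<otimes> w \<otimes> \<sigma> s))) / sqrt (wt (s \<otimes> w \<otimes> \<sigma> s)) =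
    real (card (displaced_in R w)) / sqrt (wt w)"
proof -
  have CCh: "C \<in> Ch" using C R by blast
  have t: "\<sigma> s \<in> S" using s by blast
  have w: "w \<in> carrier W" using dp_closed[OF CCh] C by simp
  have up: "real (card (displaced_in R (s \<otimes> v \<otimes> \<sigma> s))) / sqrt (wt (s \<otimes> v \<otimes> \<sigma> s)) =
    real (card (displaced_in R v)) / sqrt (wt v)"
    if v: "v \<in> carrier W" and l: "len (s \<otimes> v \<otimes> \<sigma> s) = len v + 2" for v
  proof -
    have "q s > 0"
      using weight_pos[of s] weight_reduced[of s "[s]"] s by (simp add: is_reduced_def)
    moreover from this have "sqrt (wt (s \<otimes> v \<otimes> \<sigma> s)) = q s * sqrt (wt v)"
      using weight_sandwich[OF s t v l] q_\<sigma>[OF s] by (simp add: real_sqrt_mult)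
    ultimately show ?thesis using card_displaced_up[OF R closed s v l] by simp
  qed
  let ?v = "s \<otimes> w \<otimes> \<sigma> s"
  have v: "?v \<in> carrier W" "s \<otimes> ?v \<otimes> \<sigma> s = w" using s t w by (auto simp: m_assoc)
  consider "len ?v = len w + 2" | "?v = w" | "len w = len ?v + 2"
    using dp_trichotomy[OF CCh s] unfolding C(2) by blast
  then show ?thesis
  proof cases
    case 1
    then show ?thesis using up[OF w] by blast
  next
    case 2
    then show ?thesis by simp
  next
    \<comment> \<open>The downward case is the upward one read from \<open>s w (\<sigma> s)\<close>,
      which leads back to \<open>w\<close>.\<close>
    case 3
    then show ?thesis using up[OF v(1)] unfolding v(2) by simp
  qed
qed

text \<open>For \<open>K = S\<close> this is the full twisted class of \<open>w\<close>. General
  \<open>K\<close> is what makes the count available inside a residue of type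
  \<open>K\<close>.\<close>

definition twisted_orbit :: "'a set \<Rightarrow> 'a \<Rightarrow> 'a set" where
  "twisted_orbit K w = (\<lambda>v. inv v \<otimes> w \<otimes> \<sigma> v) ` generate W K"

text \<open>Each step of the induction needs a chamber that realises the current displacement. A
  nonzero ratio supplies one, so constancy of the ratio also shows that every element of the orbit
  occurs as a displacement.\<close>

lemma displaced_ratio:
  assumes K: "K \<subseteq> S" and C: "C \<in> Ch" and v: "v \<in> twisted_orbit K (dp C)"
  shows "real (card (displaced_in (residue C K) v)) / sqrt (wt v) =
      real (card (displaced_in (residue C K) (dp C))) / sqrt (wt (dp C))"
    and "v \<in> dp ` residue C K" "v \<in> carrier W"
proof -
  let ?R = "residue C K"
  let ?f = "\<lambda>w. real (card (displaced_in ?R w)) / sqrt (wt w)"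
  have closed: "E \<in> ?R" if "s \<in> K" "D \<in> ?R" "E \<in> Ch" "\<delta> D E = s" for s D E
    using residue_trans[OF K C, of D E] that generate.incl[of s K W] by auto
  have fin: "finite (displaced_in ?R w)" for w
    using finite_chambers by (auto simp: displaced_in_def)
  have nonzero: "?f w \<noteq> 0 \<longleftrightarrow> w \<in> dp ` ?R" if "w \<in> carrier W" for w
    using weight_pos[OF that] fin[of w] by (auto simp: displaced_in_def)
  have main: "?f (inv (word_prod W ws) \<otimes> w \<otimes> \<sigma> (word_prod W ws)) = ?f w"
    if "ws \<in> lists K" "w \<in> dp ` ?R" for ws w
    using that
  proof (induction ws arbitrary: w rule: list.induct)
    case Nil
    then have "w \<in> carrier W" by auto
    then show ?case by simp
  next
    case (Cons s ws)
    have s: "s \<in> K" "s \<in> S" and ws: "ws \<in> lists K" "ws \<in> lists S" using Cons.prems(1) K by auto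
    obtain D where D: "D \<in> ?R" "dp D = w" using Cons.prems(2) by auto
    then have w: "w \<in> carrier W" by auto
    have step: "?f (s \<otimes> w \<otimes> \<sigma> s) = ?f w"
      using closed[OF s(1)] D by (intro displaced_ratio_step[OF _ _ s(2) D]) auto
    have sw: "s \<otimes> w \<otimes> \<sigma> s \<in> carrier W" using w s by blast
    have "s \<otimes> w \<otimes> \<sigma> s \<in> dp ` ?R"
      unfolding nonzero[OF sw, symmetric] step nonzero[OF w] by (rule Cons.prems(2))
    from HOL.trans[OF Cons.IH[OF ws(1) this] step] have "?f (inv (word_prod W ws) \<otimes> (s \<otimes> w \<otimes> \<sigma> s) \<otimes> \<sigma> (word_prod W ws)) = ?f w" .
    moreover have "inv (word_prod W ws) \<otimes> (s \<otimes> w \<otimes> \<sigma> s) \<otimes> \<sigma> (word_prod W ws) =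
        inv (word_prod W (s # ws)) \<otimes> w \<otimes> \<sigma> (word_prod W (s # ws))"
      using s ws w by (simp add: inv_mult_group m_assoc)
    ultimately show ?case by simp
  qed
  have d: "dp C \<in> dp ` ?R" using in_residue_self[OF C] by blast
  obtain ws where ws: "ws \<in> lists K" "v = inv (word_prod W ws) \<otimes> dp C \<otimes> \<sigma> (word_prod W ws)"
    using v generate_words[OF K] by (auto simp: twisted_orbit_def)
  show eq: "?f v = ?f (dp C)" unfolding ws(2) by (rule main[OF ws(1) d])
  have wS: "ws \<in> lists S" using lists_gens_mono[OF K] ws(1) .
  show vW: "v \<in> carrier W" unfolding ws(2) using wS C by blast
  show "v \<in> dp ` ?R" unfolding nonzero[OF vW, symmetric] eq nonzero[OF dp_closed[OF C]] by (rule d)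
qed

lemma displacements_residue:
  assumes K: "K \<subseteq> S" and C: "C \<in> Ch"
  shows "dp ` residue C K = twisted_orbit K (dp C)"
proof (intro equalityI subsetI)
  fix v assume "v \<in> dp ` residue C K"
  then obtain D where D: "D \<in> Ch" "\<delta> C D \<in> generate W K" "v = dp D" by auto
  have "dp D \<in> twisted_orbit K (dp C)"
  proof (rule residue_connected[OF K D(1), of "\<lambda>D. dp D \<in> twisted_orbit K (dp C)" C])
    fix A B s assume *: "A \<in> Ch" "B \<in> Ch" "s \<in> K" "\<delta> A B = s" "dp A \<in> twisted_orbit K (dp C)"
    have s: "s \<in> S" using * K by blast
    obtain v where v: "v \<in> generate W K" "dp A = inv v \<otimes> dp C \<otimes> \<sigma> v"
      using * by (auto simp: twisted_orbit_def)
    have vW: "v \<in> carrier W" using v generate_closed K by blast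
    have "s \<otimes> dp A \<otimes> \<sigma> s = inv (v \<otimes> s) \<otimes> dp C \<otimes> \<sigma> (v \<otimes> s)"
      unfolding v(2) using s vW C by (simp add: inv_mult_group m_assoc)
    moreover have "v \<otimes> s \<in> generate W K" by (rule generate.eng[OF v(1) generate.incl[OF *(3)]])
    ultimately have "s \<otimes> dp A \<otimes> \<sigma> s \<in> twisted_orbit K (dp C)" by (auto simp: twisted_orbit_def)
    then show "dp B \<in> twisted_orbit K (dp C)"
      using dp_adjacent[OF *(1,2) s *(4)] *(5) by auto
  next
    have "dp C = inv \<one> \<otimes> dp C \<otimes> \<sigma> \<one>" using C by simp
    then show "dp C \<in> twisted_orbit K (dp C)"
      unfolding twisted_orbit_def using generate.one[of W K] by (rule image_eqI)
  qed (use C D in auto)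
  then show "v \<in> twisted_orbit K (dp C)" using D by simp
qed (use displaced_ratio(2)[OF K C] in blast)

text \<open>The residue is partitioned by displacement, and the part with displacement
  \<open>v\<close> has size a fixed multiple of \<open>sqrt (wt v)\<close>.\<close>

lemma poincare_residue:
  assumes K: "K \<subseteq> S" and C: "C \<in> Ch"
  shows "poincare W S q (generate W K) =
    real (card (displaced_in (residue C K) (dp C))) / sqrt (wt (dp C)) *
    poincare_sqrt W S q (twisted_orbit K (dp C))"
proof -
  let ?R = "residue C K"
  let ?c = "real (card (displaced_in ?R (dp C))) / sqrt (wt (dp C))"
  have fin: "finite (twisted_orbit K (dp C))"
    unfolding displacements_residue[OF K C, symmetric] using finite_chambers by simp
  have "?R = (\<Union>v\<in>twisted_orbit K (dp C). displaced_in ?R v)"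
    unfolding displacements_residue[OF K C, symmetric] by (auto simp: displaced_in_def)
  then have "card ?R = card (\<Union>v\<in>twisted_orbit K (dp C). displaced_in ?R v)" by simp
  also have "\<dots> = (\<Sum>v\<in>twisted_orbit K (dp C). card (displaced_in ?R v))"
    using fin finite_chambers by (intro card_UN_disjoint) (auto simp: displaced_in_def)
  finally have "real (card ?R) = (\<Sum>v\<in>twisted_orbit K (dp C). real (card (displaced_in ?R v)))"
    by simp
  also have "\<dots> = (\<Sum>v\<in>twisted_orbit K (dp C). ?c * sqrt (wt v))"
  proof (rule sum.cong[OF HOL.refl])
    fix v assume "v \<in> twisted_orbit K (dp C)"
    from displaced_ratio(1,3)[OF K C this]
    show "real (card (displaced_in ?R v)) = ?c * sqrt (wt v)"
      using weight_pos[of v] by (simp add: field_simps)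
  qed
  finally show ?thesis
    using card_residue[OF K finite_group C] by (simp add: poincare_sqrt_def sum_distrib_left)
qed

end

section \<open>Fixed residues\<close>

locale fixed_structure = uniclass_automorphism +
  fixes J :: "'a set"
  assumes J: "J \<subseteq> S"
    and min: "unique_min_length W S (disp Ch \<delta> \<theta>) (longest_elt W S J)"
begin

abbreviation wJ :: 'a where
  "wJ \<equiv> longest_elt W S J"

abbreviation Ch' :: "'c set set" where
  "Ch' \<equiv> fixed_chambers W Ch \<delta> \<theta> J"

text \<open>These turn out to be the types of the fixed residues that contain a fixed chamber; see
  \<open>residue_over_fixed\<close> and \<open>fixed_residue_cases\<close>.\<close>

definition stable_types :: "'a set set" where
  "stable_types = {K. J \<subseteq> K \<and> K \<subseteq> S \<and> \<sigma> ` K = K}"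

section \<open>Minimality of \<open>wJ\<close> and stability of its type \<open>J\<close>\<close>

lemma finite_generate: "K \<subseteq> S \<Longrightarrow> finite (generate W K)"
  using finite_group generate_closed by (meson finite_subset subsetI)

lemma \<sigma>_inj_on_gens: "inj_on \<sigma> S"
  by (meson \<sigma>_inj gen_closed inj_onI)

lemma stable_if_subset:
  assumes "K \<subseteq> S" "\<sigma> ` K \<subseteq> K"
  shows "\<sigma> ` K = K"
  using assms endo_inj_surj[of K \<sigma>] finite_gens \<sigma>_inj_on_gens
  by (meson finite_subset inj_on_subset)

lemma wJ: "wJ \<in> generate W J" "wJ \<in> carrier W" "\<And>v. v \<in> generate W J \<Longrightarrow> len v \<le> len wJ"
  using longest_elt_props[OF J finite_generate[OF J]] generate_closed[OF J] by blast+

lemma dp_minimal: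
  assumes "C \<in> Ch" "len (dp C) \<le> len wJ"
  shows "dp C = wJ"
proof -
  have "dp C \<in> disp Ch \<delta> \<theta>" using assms by (auto simp: disp_def)
  then show ?thesis using min assms(2) unfolding unique_min_length_def by (meson not_less)
qed

lemma ex_dp_wJ: obtains C where "C \<in> Ch" "dp C = wJ"
proof -
  have "wJ \<in> disp Ch \<delta> \<theta>" using min by (simp add: unique_min_length_def)
  then show thesis using that by (auto simp: disp_def)
qed

lemma disp_eq_orbit: "disp Ch \<delta> \<theta> = twisted_orbit S wJ"
proof -
  obtain C where C: "C \<in> Ch" "dp C = wJ" by (rule ex_dp_wJ)
  have "residue C S = Ch" using C gens_generate dist_closed by auto
  then have "dp ` Ch = twisted_orbit S wJ"
    using displacements_residue[OF subset_refl C(1)] C(2) by simp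
  then show ?thesis by (auto simp: disp_def)
qed

text \<open>Twisted conjugation of \<open>wJ\<close> by \<open>wJ\<close> itself gives
  \<open>\<sigma> wJ\<close>, which is therefore a displacement. It has the length of
  \<open>wJ\<close>, and this minimum is attained only once.\<close>

lemma \<sigma>_wJ: "\<sigma> wJ = wJ"
proof -
  have "\<sigma> wJ = inv wJ \<otimes> wJ \<otimes> \<sigma> wJ" using wJ(2) by simp
  then have "\<sigma> wJ \<in> disp Ch \<delta> \<theta>"
    unfolding disp_eq_orbit twisted_orbit_def gens_generate using wJ(2) by (rule image_eqI)
  then obtain C where "C \<in> Ch" "dp C = \<sigma> wJ" by (auto simp: disp_def)
  then show ?thesis using dp_minimal[of C] len_\<sigma>[OF wJ(2)] by simp
qed

text \<open>The set \<open>J\<close> consists of the left descents of \<open>wJ\<close>, while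
  \<sigma> fixes \<open>wJ\<close> and preserves lengths.\<close>

lemma J_stable: "J \<in> stable_types"
proof -
  have "\<sigma> s \<in> J" if s: "s \<in> J" for s
  proof -
    have sS: "s \<in> S" using s J by blast
    have "\<sigma> (s \<otimes> wJ) = \<sigma> s \<otimes> wJ" using sS wJ(2) \<sigma>_wJ by simp
    then have "len (\<sigma> s \<otimes> wJ) = len (s \<otimes> wJ)"
      using len_\<sigma>[of "s \<otimes> wJ"] sS wJ(2) by simp
    then show ?thesis
      using longest_elt_descents[OF J finite_generate[OF J] sS]
        longest_elt_descents[OF J finite_generate[OF J] \<sigma>_gen[OF sS]] s by simp
  qed
  then show ?thesis using stable_if_subset[OF J] J by (auto simp: stable_types_def)
qed

lemma S_stable: "S \<in> stable_types"
  using J \<sigma>_gens by (simp add: stable_types_def)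

lemma Int_stable: "K \<in> stable_types \<Longrightarrow> L \<in> stable_types \<Longrightarrow> K \<inter> L \<in> stable_types"
  using inj_on_image_Int[OF \<sigma>_inj_on_gens, of K L] by (auto simp: stable_types_def)

lemma Un_stable: "K \<in> stable_types \<Longrightarrow> L \<in> stable_types \<Longrightarrow> K \<union> L \<in> stable_types"
  by (auto simp: stable_types_def image_Un)

lemma \<sigma>_parabolic:
  assumes "K \<subseteq> S" "\<sigma> ` K = K" "w \<in> carrier W"
  shows "\<sigma> w \<in> generate W K \<longleftrightarrow> w \<in> generate W K"
proof -
  have sub: "\<sigma> ` generate W K \<subseteq> generate W K"
  proof clarify
    fix w assume "w \<in> generate W K"
    then obtain ws where ws: "ws \<in> lists K" "w = word_prod W ws"
      using generate_words[OF assms(1)] by auto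
    then have "map \<sigma> ws \<in> lists K" using assms(2) by (auto simp: in_lists_conv_set)
    then show "\<sigma> w \<in> generate W K"
      using generate_words[OF assms(1)] \<sigma>_word[of ws] ws lists_gens_mono[OF assms(1)] by auto
  qed
  have "inj_on \<sigma> (generate W K)"
    using generate_closed[OF assms(1)] by (auto intro!: inj_onI simp: \<sigma>_inj)
  then have eq: "\<sigma> ` generate W K = generate W K"
    using endo_inj_surj[OF finite_generate[OF assms(1)] sub] by blast
  show ?thesis
  proof
    assume "\<sigma> w \<in> generate W K"
    then obtain v where "v \<in> generate W K" "\<sigma> v = \<sigma> w" using eq by force
    then show "w \<in> generate W K"
      using \<sigma>_inj[of v w] generate_closed[OF assms(1)] assms(3) by auto
  qed (use sub in blast)
qed

section \<open>Fixed residues and their chambers\<close>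

lemma \<theta>_residue:
  assumes K: "K \<subseteq> S" "\<sigma> ` K = K" and C: "C \<in> Ch"
  shows "\<theta> ` residue C K = residue (\<theta> C) K"
proof -
  have iff: "\<theta> D \<in> residue (\<theta> C) K \<longleftrightarrow> D \<in> residue C K" if "D \<in> Ch" for D
    using dist_\<theta>[OF C that] \<sigma>_parabolic[OF K dist_closed[OF C that]] that by simp
  show ?thesis
  proof (intro equalityI subsetI)
    fix E assume E: "E \<in> residue (\<theta> C) K"
    then obtain D where "D \<in> Ch" "E = \<theta> D" using \<theta>_bij by (auto simp: bij_betw_def)
    then show "E \<in> \<theta> ` residue C K" using iff E by blast
  qed (use iff in auto)
qed

lemma residue_fixed:
  assumes K: "K \<in> stable_types" and C: "C \<in> Ch" "dp C = wJ"
  shows "\<theta> ` residue C K = residue C K"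
proof -
  have K': "J \<subseteq> K" "K \<subseteq> S" "\<sigma> ` K = K" using K by (auto simp: stable_types_def)
  have "\<theta> C \<in> residue C K"
    using C wJ(1) mono_generate[OF K'(1)] by auto
  then show ?thesis
    using \<theta>_residue[OF K'(2,3) C(1)] residue_eq[OF K'(2) C(1)] by blast
qed

lemma fixed_chamber_residue:
  assumes "C \<in> Ch" "dp C = wJ"
  shows "residue C J \<in> Ch'"
  using residue_fixed[OF J_stable assms] assms
  by (auto simp: fixed_chambers_def residues_of_type_def)

text \<open>Inside a fixed residue of type \<open>J\<close> displacements lie in the parabolic
  subgroup of \<open>J\<close>, where no element is longer than \<open>wJ\<close>; minimality then
  forces \<open>wJ\<close>.\<close>

lemma fixed_chamberD:
  assumes T: "T \<in> Ch'" and C: "C \<in> T"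
  shows "C \<in> Ch" "T = residue C J" "dp C = wJ"
proof -
  obtain D where D: "D \<in> Ch" "T = residue D J" and fxd: "\<theta> ` T = T"
    using T by (auto simp: fixed_chambers_def residues_of_type_def)
  show Ch: "C \<in> Ch" using D C by auto
  show TC: "T = residue C J" using residue_eq[OF J D(1)] D C by blast
  have "\<theta> C \<in> T" using fxd C by blast
  then have "dp C \<in> generate W J" unfolding TC by auto
  then show "dp C = wJ" using dp_minimal[OF Ch wJ(3)] by blast
qed

lemma fixed_chamber_nonempty:
  assumes "T \<in> Ch'"
  obtains C where "C \<in> T" "C \<in> Ch" "T = residue C J" "dp C = wJ"
proof -
  obtain D where "D \<in> Ch" "T = residue D J"
    using assms by (auto simp: fixed_chambers_def residues_of_type_def)
  then have "D \<in> T" using in_residue_self[of D J] by simp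
  then show thesis using that[of D] fixed_chamberD[OF assms] by blast
qed

lemma fixed_chambers_disjoint:
  assumes "T \<in> Ch'" "T' \<in> Ch'" "T \<noteq> T'"
  shows "T \<inter> T' = {}"
  using fixed_chamberD(2)[OF assms(1)] fixed_chamberD(2)[OF assms(2)] assms(3) by blast

lemma finite_fixed_chambers: "finite Ch'"
proof (rule finite_subset)
  show "Ch' \<subseteq> Pow Ch" by (auto simp: fixed_chambers_def residues_of_type_def)
qed (use finite_chambers in simp)

lemma card_displaced_wJ:
  assumes K: "J \<subseteq> K" "K \<subseteq> S" and C: "C \<in> Ch"
  shows "real (card (displaced_in (residue C K) wJ)) =
    real (card {T \<in> Ch'. T \<subseteq> residue C K}) * poincare W S q (generate W J)"
proof -
  let ?A = "{T \<in> Ch'. T \<subseteq> residue C K}"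
  have "displaced_in (residue C K) wJ = \<Union>?A"
  proof (intro equalityI subsetI)
    fix D assume "D \<in> displaced_in (residue C K) wJ"
    then have D: "D \<in> residue C K" "D \<in> Ch" "dp D = wJ" by (auto simp: displaced_in_def)
    have "residue D J \<subseteq> residue D K" using mono_generate[OF K(1)] by blast
    then have "residue D J \<subseteq> residue C K" using residue_eq[OF K(2) C D(1)] by simp
    then have "residue D J \<in> ?A" using fixed_chamber_residue[OF D(2,3)] by blast
    then show "D \<in> \<Union>?A" using in_residue_self[OF D(2)] by blast
  next
    fix D assume "D \<in> \<Union>?A"
    then obtain T where "T \<in> Ch'" "T \<subseteq> residue C K" "D \<in> T" by blast
    then show "D \<in> displaced_in (residue C K) wJ"
      using fixed_chamberD(3) unfolding displaced_in_def by blast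
  qed
  moreover have "card (\<Union>?A) = (\<Sum>T\<in>?A. card T)"
  proof (rule card_Union_disjoint)
    show "pairwise disjnt ?A" using fixed_chambers_disjoint by (auto simp: pairwise_def disjnt_def)
    fix T assume "T \<in> ?A"
    then show "finite T" using finite_subset[of T "residue C K"] finite_chambers by auto
  qed
  moreover have "(\<Sum>T\<in>?A. real (card T)) = (\<Sum>T\<in>?A. poincare W S q (generate W J))"
  proof (rule sum.cong[OF HOL.refl])
    fix T assume "T \<in> ?A"
    then obtain D where "D \<in> Ch" "T = residue D J" using fixed_chamber_nonempty by blast
    then show "real (card T) = poincare W S q (generate W J)"
      using card_residue[OF J finite_group] by simp
  qed
  ultimately show ?thesis by simp
qed

section \<open>The number of fixed chambers in a fixed residue\<close>

lemma poincare_pos: "U \<noteq> {} \<Longrightarrow> U \<subseteq> carrier W \<Longrightarrow> poincare W S q U > 0"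
  using finite_group weight_pos unfolding poincare_def
  by (intro sum_pos) (auto intro: finite_subset)

lemma poincare_fixed:
  assumes K: "J \<subseteq> K" "K \<subseteq> S" and C: "C \<in> Ch" "dp C = wJ"
  shows "poincare W S q (generate W K) =
    real (card {T \<in> Ch'. T \<subseteq> residue C K}) *
    (poincare W S q (generate W J) / sqrt (wt wJ) * poincare_sqrt W S q (twisted_orbit K wJ))"
  using poincare_residue[OF K(2) C(1)] unfolding C(2) card_displaced_wJ[OF K C(1)] by simp

text \<open>In \<open>poincare_fixed\<close> every factor other than the count depends on
  \<open>K\<close> alone. The left side is positive, so these factors are nonzero and can be
  cancelled.\<close>

lemma card_fixed_determined:
  assumes K: "J \<subseteq> K" "K \<subseteq> S" and C: "C \<in> Ch" "dp C = wJ" and D: "D \<in> Ch" "dp D = wJ"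
  shows "card {T \<in> Ch'. T \<subseteq> residue C K} = card {T \<in> Ch'. T \<subseteq> residue D K}"
proof -
  have "poincare W S q (generate W K) > 0"
    using poincare_pos[of "generate W K"] generate.one[of W K] generate_closed[OF K(2)] by blast
  then show ?thesis
    using poincare_fixed[OF K C] poincare_fixed[OF K D] by auto
qed

section \<open>Types of the fixed residues through a fixed chamber\<close>

definition residue_over :: "'c set \<Rightarrow> 'a set \<Rightarrow> 'c set" where
  "residue_over T K = {D \<in> Ch. \<exists>C\<in>T. \<delta> C D \<in> generate W K}"

text \<open>The map that \<open>is_fixed_building\<close> requires to be a bijection onto the
  residues of the fixed building.\<close>

definition below :: "'c set \<Rightarrow> 'c set set" where
  "below R = {T \<in> Ch'. T \<subseteq> R}"

text \<open>All chambers of \<open>T\<close> lie in one residue of type \<open>K\<close> because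
  \<open>J \<subseteq> K\<close>, so any of them may represent \<open>T\<close>.\<close>

lemma residue_over_eq:
  assumes T: "T \<in> Ch'" and C: "C \<in> T" and K: "J \<subseteq> K" "K \<subseteq> S"
  shows "residue_over T K = residue C K"
proof -
  have "residue D K = residue C K" if "D \<in> T" for D
  proof -
    have "D \<in> residue C K"
      using fixed_chamberD(2)[OF T C] that mono_generate[OF K(1)] by blast
    then show ?thesis using residue_eq[OF K(2)] fixed_chamberD(1)[OF T C] by blast
  qed
  then have "D' \<in> residue C K" if "D' \<in> Ch" "D \<in> T" "\<delta> D D' \<in> generate W K" for D D'
    using that by blast
  then show ?thesis unfolding residue_over_def using C by blast
qed

lemma subset_residue_over:
  assumes "T \<in> Ch'" "J \<subseteq> K" "K \<subseteq> S"
  shows "T \<subseteq> residue_over T K"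
proof -
  obtain C where C: "C \<in> T" "T = residue C J" using fixed_chamber_nonempty[OF assms(1)] by metis
  have "residue C J \<subseteq> residue C K" using mono_generate[OF assms(2)] by blast
  then show ?thesis using residue_over_eq[OF assms(1) C(1) assms(2,3)] C(2) by simp
qed

lemma residue_over_fixed:
  assumes T: "T \<in> Ch'" and K: "K \<in> stable_types"
  shows "residue_over T K \<in> fixed_residues W S Ch \<delta> \<theta>"
proof -
  obtain C where C: "C \<in> T" "C \<in> Ch" "dp C = wJ" using fixed_chamber_nonempty[OF T] by metis
  have K': "J \<subseteq> K" "K \<subseteq> S" using K by (auto simp: stable_types_def)
  show ?thesis
    unfolding residue_over_eq[OF T C(1) K'] fixed_residues_def residues_def residues_of_type_def
    using residue_fixed[OF K C(2,3)] C(2) K'(2) by blast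
qed

text \<open>A generator in \<open>K\<close> is witnessed by a chamber at that distance from
  \<open>C\<close>; this lets an inclusion of residues reveal the inclusion of types.\<close>

lemma residue_over_mono_iff:
  assumes T: "T \<in> Ch'" and K: "J \<subseteq> K" "K \<subseteq> S" and L: "J \<subseteq> L" "L \<subseteq> S"
  shows "residue_over T K \<subseteq> residue_over T L \<longleftrightarrow> K \<subseteq> L"
proof
  obtain C where C: "C \<in> T" "C \<in> Ch" using fixed_chamber_nonempty[OF T] by metis
  assume sub: "residue_over T K \<subseteq> residue_over T L"
  show "K \<subseteq> L"
  proof
    fix s assume s: "s \<in> K"
    then have sS: "s \<in> S" using K by blast
    obtain D where D: "D \<in> Ch" "\<delta> C D = s" using ex_dist[OF C(2), of s] sS by blast
    then have "D \<in> residue_over T K"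
      unfolding residue_over_eq[OF T C(1) K] using generate.incl[OF s, of W] by blast
    then have "s \<in> generate W L" using sub D unfolding residue_over_eq[OF T C(1) L] by blast
    then show "s \<in> L" using gen_in_parabolic[OF L(2) sS] by blast
  qed
next
  assume "K \<subseteq> L"
  then show "residue_over T K \<subseteq> residue_over T L" unfolding residue_over_def using mono_generate[of K L] by blast
qed

lemma residue_over_Int:
  assumes T: "T \<in> Ch'" and K: "J \<subseteq> K" "K \<subseteq> S" and L: "J \<subseteq> L" "L \<subseteq> S"
  shows "residue_over T (K \<inter> L) = residue_over T K \<inter> residue_over T L"
proof -
  obtain C where C: "C \<in> T" using fixed_chamber_nonempty[OF T] by metis
  have KL: "J \<subseteq> K \<inter> L" "K \<inter> L \<subseteq> S" using K L by blast+
  show ?thesis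
    unfolding residue_over_eq[OF T C K] residue_over_eq[OF T C L] residue_over_eq[OF T C KL]
      parabolic_Int[OF K(2) L(2), symmetric] by blast
qed

text \<open>Both conditions on the type \<open>K\<close> are read off from neighbours of a chamber
  \<open>C\<close> of \<open>T\<close>. A neighbour of type \<open>s\<close> in \<open>J\<close>
  lies in \<open>T\<close>, hence in \<open>R\<close>. A neighbour of type \<open>s\<close> in
  \<open>K\<close> lies in \<open>R\<close>, and \<theta> carries it to a neighbour of
  \<open>\<theta> C\<close> of type \<open>\<sigma> s\<close>, again in \<open>R\<close>.\<close>

lemma fixed_residue_cases:
  assumes R: "R \<in> fixed_residues W S Ch \<delta> \<theta>" and T: "T \<in> Ch'" "T \<subseteq> R"
  shows "\<exists>K\<in>stable_types. R = residue_over T K"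
proof -
  obtain K D where K: "K \<subseteq> S" and D: "D \<in> Ch" "R = residue D K" and fxd: "\<theta> ` R = R"
    using R by (auto simp: fixed_residues_def residues_def residues_of_type_def)
  obtain C where C: "C \<in> T" "C \<in> Ch" "T = residue C J" using fixed_chamber_nonempty[OF T(1)] by metis
  have RC: "R = residue C K" using residue_eq[OF K D(1), of C] D(2) T(2) C(1) by blast
  have "J \<subseteq> K"
  proof
    fix s assume s: "s \<in> J"
    then have sS: "s \<in> S" using J by blast
    obtain E where E: "E \<in> Ch" "\<delta> C E = s" using ex_dist[OF C(2), of s] sS by blast
    then have "E \<in> T" unfolding C(3) using generate.incl[OF s, of W] by blast
    then have "s \<in> generate W K" using T(2) E unfolding RC by blast
    then show "s \<in> K" using gen_in_parabolic[OF K sS] by blast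
  qed
  have "\<sigma> ` K \<subseteq> K"
  proof
    fix t assume "t \<in> \<sigma> ` K"
    then obtain s where s: "s \<in> K" "t = \<sigma> s" by blast
    then have sS: "s \<in> S" using K by blast
    obtain E where E: "E \<in> Ch" "\<delta> C E = s" using ex_dist[OF C(2), of s] sS by blast
    then have "E \<in> R" unfolding RC using generate.incl[OF s(1), of W] by blast
    then have R2: "\<theta> E \<in> R" "\<theta> C \<in> R" using fxd T(2) C(1) by blast+
    then have "\<delta> (\<theta> C) (\<theta> E) \<in> generate W K"
      using residue_eq[OF K C(2), of "\<theta> C"] unfolding RC by blast
    then have "t \<in> generate W K" using \<theta>_adjacent[OF C(2) E(1) sS] E(2) s(2) by simp
    then show "t \<in> K" using gen_in_parabolic[OF K \<sigma>_gen[OF sS]] s(2) by blast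
  qed
  then have "K \<in> stable_types"
    using stable_if_subset[OF K] K \<open>J \<subseteq> K\<close> by (simp add: stable_types_def)
  moreover have "R = residue_over T K" using residue_over_eq[OF T(1) C(1) \<open>J \<subseteq> K\<close> K] RC by simp
  ultimately show ?thesis by blast
qed

end

section \<open>Regularity of the fixed building\<close>

locale fixed_building = fixed_structure W S Ch \<delta> \<theta> \<sigma> J + F: building W' S' "fixed_chambers W Ch \<delta> \<theta> J" \<delta>'
  for W :: "('a, 'm) monoid_scheme" (structure) and S and Ch :: "'c set" and \<delta> and \<theta> and \<sigma> and J
    and W' :: "('b, 'n) monoid_scheme" and S' and \<delta>' +
  assumes below_bij: "bij_betw below (fixed_residues W S Ch \<delta> \<theta>) (residues W' S' Ch' \<delta>')"
begin

text \<open>Bijectivity of \<open>below\<close> says nothing directly about inclusions. An inclusion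
  is first rewritten as an equality involving \<open>K \<inter> L\<close>, to which injectivity
  applies.\<close>

lemma below_over_mono_iff:
  assumes T: "T \<in> Ch'" and K: "K \<in> stable_types" and L: "L \<in> stable_types"
  shows "below (residue_over T K) \<subseteq> below (residue_over T L) \<longleftrightarrow> K \<subseteq> L"
proof
  have K': "J \<subseteq> K" "K \<subseteq> S" and L': "J \<subseteq> L" "L \<subseteq> S"
    using K L by (auto simp: stable_types_def)
  have KL': "J \<subseteq> K \<inter> L" "K \<inter> L \<subseteq> S" using K' L' by blast+
  assume sub: "below (residue_over T K) \<subseteq> below (residue_over T L)"
  have "below (residue_over T (K \<inter> L)) = below (residue_over T K)"
    unfolding residue_over_Int[OF T K' L'] using sub by (auto simp: below_def)
  then have "residue_over T (K \<inter> L) = residue_over T K"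
    using below_bij residue_over_fixed[OF T K] residue_over_fixed[OF T Int_stable[OF K L]]
    by (meson bij_betw_def inj_onD)
  then have "K \<subseteq> K \<inter> L"
    using residue_over_mono_iff[OF T K' KL'] by simp
  then show "K \<subseteq> L" by blast
next
  have K': "J \<subseteq> K" "K \<subseteq> S" and L': "J \<subseteq> L" "L \<subseteq> S"
    using K L by (auto simp: stable_types_def)
  assume "K \<subseteq> L"
  then show "below (residue_over T K) \<subseteq> below (residue_over T L)"
    using residue_over_mono_iff[OF T K' L'] by (auto simp: below_def)
qed

lemma F_residue_mono_iff:
  assumes T: "T \<in> Ch'" and I: "I \<subseteq> S'" and I2: "I2 \<subseteq> S'"
  shows "F.residue T I \<subseteq> F.residue T I2 \<longleftrightarrow> I \<subseteq> I2"
proof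
  assume sub: "F.residue T I \<subseteq> F.residue T I2"
  show "I \<subseteq> I2"
  proof
    fix s assume s: "s \<in> I"
    then have sS: "s \<in> S'" using I by blast
    obtain E where E: "E \<in> Ch'" "\<delta>' T E = s" using F.ex_dist[OF T, of s] sS by blast
    then have "E \<in> F.residue T I" using generate.incl[OF s, of W'] by blast
    then have "s \<in> generate W' I2" using sub E by blast
    then show "s \<in> I2" using F.gen_in_parabolic[OF I2 sS] by blast
  qed
next
  assume "I \<subseteq> I2"
  then show "F.residue T I \<subseteq> F.residue T I2" using F.mono_generate[of I I2] by blast
qed

text \<open>At every fixed chamber \<open>T\<close> the types of the residues of the fixed building containing \<open>T\<close>
  correspond to the \<open>\<sigma>\<close>-stable types containing \<open>J\<close>, as ordered sets.\<close>

definition type_rel :: "'c set \<Rightarrow> 'b set \<Rightarrow> 'a set \<Rightarrow> bool" where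
  "type_rel T I K \<longleftrightarrow> I \<subseteq> S' \<and> K \<in> stable_types \<and> below (residue_over T K) = F.residue T I"

lemma type_rel_mono_iff:
  assumes T: "T \<in> Ch'" and "type_rel T I K" "type_rel T I2 K2"
  shows "I \<subseteq> I2 \<longleftrightarrow> K \<subseteq> K2"
  using F_residue_mono_iff[OF T, of I I2] below_over_mono_iff[OF T, of K K2] assms(2,3)
  unfolding type_rel_def by simp

lemma ex_type_rel_left:
  assumes T: "T \<in> Ch'" and I: "I \<subseteq> S'"
  shows "\<exists>K. type_rel T I K"
proof -
  have "F.residue T I \<in> residues W' S' Ch' \<delta>'"
    using T I unfolding residues_def residues_of_type_def by blast
  then have "F.residue T I \<in> below ` fixed_residues W S Ch \<delta> \<theta>"
    using below_bij by (simp add: bij_betw_def)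
  then obtain R where R: "R \<in> fixed_residues W S Ch \<delta> \<theta>" "below R = F.residue T I" by auto
  then have "T \<subseteq> R" using F.in_residue_self[OF T, of I] unfolding below_def by blast
  then show ?thesis
    using fixed_residue_cases[OF R(1) T] R(2) I unfolding type_rel_def by blast
qed

lemma ex_type_rel_right:
  assumes T: "T \<in> Ch'" and K: "K \<in> stable_types"
  shows "\<exists>I. type_rel T I K"
proof -
  have "below (residue_over T K) \<in> residues W' S' Ch' \<delta>'"
    using below_bij residue_over_fixed[OF T K] by (meson bij_betwE)
  then obtain I T1 where I: "I \<subseteq> S'" "T1 \<in> Ch'" "below (residue_over T K) = F.residue T1 I"
    by (auto simp: residues_def residues_of_type_def)
  have "T \<in> below (residue_over T K)"
    using subset_residue_over[OF T, of K] K T by (auto simp: below_def stable_types_def)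
  then have "T \<in> F.residue T1 I" using I(3) by simp
  then have "F.residue T I = F.residue T1 I" using F.residue_eq[OF I(1,2)] by blast
  then show ?thesis using I K unfolding type_rel_def by blast
qed

text \<open>Among the subsets of \<open>S'\<close>, the sets \<open>{s}\<close> and
  \<open>S' - {s}\<close> are complements. Stable types are closed under intersection and union, so
  meet and join transfer: \<open>A \<inter> B\<close> is \<open>J\<close> and
  \<open>A \<union> B\<close> is \<open>S\<close>. Thus \<open>B\<close> determines
  \<open>A\<close>.\<close>

lemma type_rel_complement:
  assumes T: "T \<in> Ch'" and s: "s \<in> S'" and A: "type_rel T {s} A" and B: "type_rel T (S' - {s}) B"
  shows "A = J \<union> (S - B)"
proof -
  note mono = type_rel_mono_iff[OF T]
  have st: "A \<in> stable_types" "B \<in> stable_types" using A B by (auto simp: type_rel_def)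
  obtain I where I: "type_rel T I (A \<inter> B)"
    using ex_type_rel_right[OF T Int_stable[OF st]] by blast
  obtain IJ where IJ: "type_rel T IJ J" using ex_type_rel_right[OF T J_stable] by blast
  have "I \<subseteq> {s}" "I \<subseteq> S' - {s}" using mono[OF I A] mono[OF I B] by blast+
  then have "I \<subseteq> IJ" by blast
  then have 1: "A \<inter> B \<subseteq> J" using mono[OF I IJ] by simp
  obtain I' where I': "type_rel T I' (A \<union> B)"
    using ex_type_rel_right[OF T Un_stable[OF st]] by blast
  obtain IS where IS: "type_rel T IS S" using ex_type_rel_right[OF T S_stable] by blast
  have "{s} \<subseteq> I'" "S' - {s} \<subseteq> I'" using mono[OF A I'] mono[OF B I'] by blast+
  moreover have "IS \<subseteq> S'" using IS by (simp add: type_rel_def)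
  ultimately have "IS \<subseteq> I'" by blast
  then have 2: "S \<subseteq> A \<union> B" using mono[OF IS I'] by simp
  show ?thesis using 1 2 st by (auto simp: stable_types_def)
qed

lemma type_rel_shift:
  assumes T: "T \<in> Ch'" and T1: "T1 \<in> F.residue T I" and r: "type_rel T I K"
  shows "type_rel T1 I K" "residue_over T1 K = residue_over T K"
proof -
  have I: "I \<subseteq> S'" and K: "J \<subseteq> K" "K \<subseteq> S" and eq: "below (residue_over T K) = F.residue T I"
    using r by (auto simp: type_rel_def stable_types_def)
  have T1': "T1 \<in> Ch'" "T1 \<subseteq> residue_over T K" using T1 eq by (auto simp: below_def)
  obtain C where C: "C \<in> T" "C \<in> Ch" using fixed_chamber_nonempty[OF T] by metis
  obtain D where D: "D \<in> T1" "D \<in> Ch" using fixed_chamber_nonempty[OF T1'(1)] by metis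
  have "D \<in> residue C K" using D T1'(2) unfolding residue_over_eq[OF T C(1) K] by blast
  then show over: "residue_over T1 K = residue_over T K"
    unfolding residue_over_eq[OF T C(1) K] residue_over_eq[OF T1'(1) D(1) K]
    by (rule residue_eq[OF K(2) C(2)])
  have "F.residue T1 I = F.residue T I" using F.residue_eq[OF I T T1] .
  then show "type_rel T1 I K" using r over unfolding type_rel_def by simp
qed

text \<open>Crossing an \<open>s\<close>-panel stays in the residue of type \<open>{s}\<close>.
  Crossing a \<open>t\<close>-panel with \<open>t \<noteq> s\<close> stays in the residue of type
  \<open>S' - {s}\<close>, so \<open>B\<close> is kept and \<open>type_rel_complement\<close>
  recovers \<open>A\<close> from it.\<close>

lemma type_rel_const:
  assumes T: "T \<in> Ch'" and T1: "T1 \<in> Ch'" and s: "s \<in> S'" and r: "type_rel T {s} A"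
  shows "type_rel T1 {s} A"
proof (rule F.residue_connected[OF subset_refl T1, of "\<lambda>T. type_rel T {s} A" T])
  fix U V t assume U: "U \<in> Ch'" and V: "V \<in> Ch'" and t: "t \<in> S'" and UV: "\<delta>' U V = t"
    and r: "type_rel U {s} A"
  have V_in: "V \<in> F.residue U I" if "t \<in> I" for I
    using V UV generate.incl[OF that, of W'] by simp
  show "type_rel V {s} A"
  proof (cases "t = s")
    case True
    then show ?thesis using type_rel_shift(1)[OF U V_in r] by blast
  next
    case False
    obtain B where B: "type_rel U (S' - {s}) B" using ex_type_rel_left[OF U, of "S' - {s}"] by blast
    have B': "type_rel V (S' - {s}) B" using type_rel_shift(1)[OF U V_in B] False t by blast
    obtain A' where A': "type_rel V {s} A'" using ex_type_rel_left[OF V, of "{s}"] s by blast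
    have "A' = A"
      using type_rel_complement[OF U s r B] type_rel_complement[OF V s A' B'] by simp
    then show ?thesis using A' by simp
  qed
qed (use T T1 r F.gens_generate F.dist_closed in auto)

lemma fixed_regular:
  assumes T: "T \<in> Ch'" and T1: "T1 \<in> Ch'" and s: "s \<in> S'"
  shows "card (F.sphere T s) = card (F.sphere T1 s)"
proof -
  obtain A where A: "type_rel T {s} A" using ex_type_rel_left[OF T, of "{s}"] s by blast
  have A1: "type_rel T1 {s} A" by (rule type_rel_const[OF T T1 s A])
  have AS: "J \<subseteq> A" "A \<subseteq> S" using A by (auto simp: type_rel_def stable_types_def)
  \<comment> \<open>A panel contains \<open>U\<close> itself, which the sphere omits, so their sizes
    differ by one.\<close>
  have sphere: "F.residue U {s} = insert U (F.sphere U s)" "U \<notin> F.sphere U s" if "U \<in> Ch'" for U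
    unfolding F.generate_singleton[OF s]
    using that F.WD1[OF that] F.gen_not_one[OF s] by auto
  have card: "card (F.residue U {s}) = Suc (card (F.sphere U s))" if "U \<in> Ch'" for U
    using sphere[OF that] finite_fixed_chambers by simp
  obtain C where C: "C \<in> T" "C \<in> Ch" "dp C = wJ" using fixed_chamber_nonempty[OF T] by metis
  obtain D where D: "D \<in> T1" "D \<in> Ch" "dp D = wJ" using fixed_chamber_nonempty[OF T1] by metis
  \<comment> \<open>Both panels come from fixed residues of the same type \<open>A\<close>, and
    \<open>A\<close> determines the number of fixed chambers in them.\<close>
  have "card (below (residue_over T A)) = card (below (residue_over T1 A))"
    unfolding below_def residue_over_eq[OF T C(1) AS] residue_over_eq[OF T1 D(1) AS]
    by (rule card_fixed_determined[OF AS C(2,3) D(2,3)])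
  then have "card (F.residue T {s}) = card (F.residue T1 {s})"
    using A A1 by (simp add: type_rel_def)
  then show ?thesis using card[OF T] card[OF T1] by simp
qed

lemma card_fixed_chambers:
  assumes "finite (carrier W')"
  shows "poincare W' S' (param Ch' \<delta>') (carrier W') = real (card Ch')"
proof -
  have "regular_building W' S' Ch' \<delta>'"
    by (rule regular_building.intro[OF F.building_axioms
          regular_building_axioms.intro[OF finite_fixed_chambers fixed_regular]])
  from regular_building.card_chambers[OF this assms] show ?thesis by simp
qed

end

section \<open>Assembling the counting formulas\<close>

theorem theorem5p1:
  fixes W :: "('a, 'm) monoid_scheme" and S J :: "'a set"
    and Ch :: "'c set" and \<delta> :: "'c \<Rightarrow> 'c \<Rightarrow> 'a"
    and \<theta> :: "'c \<Rightarrow> 'c" and \<sigma> :: "'a \<Rightarrow> 'a"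
    and W' :: "('b, 'n) monoid_scheme" and S' :: "'b set"
    and \<delta>' :: "'c set \<Rightarrow> 'c set \<Rightarrow> 'b"
  defines "q \<equiv> param Ch \<delta>"
    and "Ch' \<equiv> fixed_chambers W Ch \<delta> \<theta> J"
    and "q' \<equiv> param (fixed_chambers W Ch \<delta> \<theta> J) \<delta>'"
    and "w\<^sub>J \<equiv> longest_elt W S J"
  assumes "building W S Ch \<delta>"
    and "finite (carrier W)"
    and "irreducible_coxeter W S"
    and "thick S Ch \<delta>"
    and "finite Ch"
    and "building_automorphism W S Ch \<delta> \<theta> \<sigma>"
    and "uniclass W Ch \<delta> \<theta> \<sigma>"
    and "J \<subseteq> S"
    and "unique_min_length W S (disp Ch \<delta> \<theta>) w\<^sub>J"
    and "is_fixed_building W S Ch \<delta> \<theta> J W' S' \<delta>'"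
  shows "(\<forall>w \<in> disp Ch \<delta> \<theta>.
            real (card (displaced Ch \<delta> \<theta> w)) =
              poincare W S q (generate W J) * poincare W' S' q' (carrier W') *
              sqrt (weight W S q w) / sqrt (weight W S q w\<^sub>J))
       \<and> poincare_sqrt W S q (disp Ch \<delta> \<theta>) =
           poincare W S q (carrier W) * sqrt (weight W S q w\<^sub>J) /
           (poincare W S q (generate W J) * poincare W' S' q' (carrier W'))
       \<and> poincare W' S' q' (carrier W') = real (card Ch')"
proof -
  interpret building W S Ch \<delta> by fact
  have "fixed_structure W S Ch \<delta> \<theta> \<sigma> J"
  proof (unfold_locales)
    show "card {E \<in> Ch. \<delta> C E = s} = card {E \<in> Ch. \<delta> D E = s}"
      if "C \<in> Ch" "D \<in> Ch" "s \<in> S" for C D s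
      using thick_regular[OF \<open>finite Ch\<close> \<open>finite (carrier W)\<close> \<open>thick S Ch \<delta>\<close>] that by blast
  \<comment> \<open>The first four assumptions are the defining equations; the hypotheses proper
    start at the fifth.\<close>
  qed (use assms(5-) in \<open>simp_all add: w\<^sub>J_def\<close>)
  then interpret fixed_structure W S Ch \<delta> \<theta> \<sigma> J .
  have F: "building W' S' (fixed_chambers W Ch \<delta> \<theta> J) \<delta>'" and finW': "finite (carrier W')"
    and bij: "bij_betw below (fixed_residues W S Ch \<delta> \<theta>)
      (residues W' S' (fixed_chambers W Ch \<delta> \<theta> J) \<delta>')"
    using \<open>is_fixed_building W S Ch \<delta> \<theta> J W' S' \<delta>'\<close> unfolding is_fixed_building_def below_def
    by simp_all
  have FB: "fixed_building W S Ch \<delta> \<theta> \<sigma> J W' S' \<delta>'"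
    by (rule fixed_building.intro[OF fixed_structure_axioms F fixed_building_axioms.intro[OF bij]])
  have card': "poincare W' S' q' (carrier W') = real (card Ch')"
    unfolding q'_def Ch'_def by (rule fixed_building.card_fixed_chambers[OF FB finW'])
  obtain C where C: "C \<in> Ch" "dp C = w\<^sub>J" unfolding w\<^sub>J_def by (rule ex_dp_wJ)
  \<comment> \<open>With \<open>K = S\<close> the results on residues speak about all of
    \<open>Ch\<close>.\<close>
  have RCh: "residue C S = Ch" using C(1) gens_generate dist_closed by auto
  have below: "{T \<in> Ch'. T \<subseteq> Ch} = Ch'"
    by (auto simp: Ch'_def fixed_chambers_def residues_of_type_def)
  have base: "real (card (displaced_in Ch w\<^sub>J)) = real (card Ch') * poincare W S q (generate W J)"
    using card_displaced_wJ[OF J subset_refl C(1)] below unfolding RCh Ch'_def w\<^sub>J_def q_def by simp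
  have pos: "wt w\<^sub>J > 0" "poincare W S q (generate W J) > 0" "card Ch' > 0"
  proof -
    show "wt w\<^sub>J > 0" using weight_pos wJ(2) unfolding w\<^sub>J_def by blast
    show "poincare W S q (generate W J) > 0"
      unfolding q_def using poincare_pos generate_closed[OF J] generate.one[of W J] by blast
    show "card Ch' > 0"
      using finite_fixed_chambers building.chambers_nonempty[OF F] unfolding Ch'_def by (simp add: card_gt_0_iff)
  qed
  have "real (card (displaced Ch \<delta> \<theta> w)) =
      poincare W S q (generate W J) * poincare W' S' q' (carrier W') *
      sqrt (weight W S q w) / sqrt (weight W S q w\<^sub>J)" if w: "w \<in> disp Ch \<delta> \<theta>" for w
  proof -
    have w': "w \<in> twisted_orbit S (dp C)" using w disp_eq_orbit C(2) w\<^sub>J_def by simp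
    have "displaced Ch \<delta> \<theta> w = displaced_in Ch w" by (simp add: displaced_def displaced_in_def)
    moreover have "wt w > 0" using displaced_ratio(3)[OF subset_refl C(1) w'] weight_pos by blast
    ultimately show ?thesis
      using displaced_ratio(1)[OF subset_refl C(1) w'] pos(1) base
      unfolding RCh C(2) card' q_def by (simp add: field_simps)
  qed
  \<comment> \<open>The sum over all displacements; since its constant factor is positive, it can be
    solved for the sum of the square roots.\<close>
  moreover have "poincare W S q (carrier W) =
      real (card Ch') * poincare W S q (generate W J) / sqrt (wt w\<^sub>J) * poincare_sqrt W S q (disp Ch \<delta> \<theta>)"
    using poincare_residue[OF subset_refl C(1)] base disp_eq_orbit
    unfolding RCh C(2) q_def w\<^sub>J_def by (simp add: gens_generate)
  then have "poincare_sqrt W S q (disp Ch \<delta> \<theta>) =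
      poincare W S q (carrier W) * sqrt (weight W S q w\<^sub>J) /
      (poincare W S q (generate W J) * poincare W' S' q' (carrier W'))"
    unfolding card' using pos unfolding q_def by (simp add: field_simps)
  ultimately show ?thesis using card' by blast
qed

end
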